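(* The Virasoro algebra $\mathfrak{Vir}$ acts on $H=\mathcal F_{NS}$ through the operators $L_n$ ($n\in\mathbb Z$) defined in the context, and the minimal submodule of $\mathcal F_{NS}$ containing $\Omega$ is isomorphic to $L(c,h)=L(\tfrac12,0)$.
   Context: The fermion algebra is generated by $(\psi_n)_{n\in\mathbb Z+1/2}$ and $I$ central, with $[\psi_m,\psi_n]_+=\delta_{m+n,0}I$, $\psi_n^\star=\psi_{-n}$. $H=\mathcal F_{NS}$ is its module freely generated by a vector $\Omega\ne0$ with $\psi_m\Omega=0$ for $m>0$ and $I\Omega=\Omega$; it is a prehilbert space for the inner product with $(\Omega,\Omega)=1$ and $(\psi_nu,v)=(u,\psi_{-n}v)$, with orthonormal basis $\psi_{-m_1}\cdots\psi_{-m_r}\Omega$, $m_1<\dots<m_r$, $m_i\in\mathbb N+\frac12$. Write $\psi(n)=\psi_{n+1/2}$ for $n\in\mathbb Z$. The operators $L_n$ are given by $L(z)=\sum_nL_nz^{-n-2}=\frac12\psi_{-2}\psi(z)$, that is $$L_{n}=\tfrac12\sum_{p\ge0}(p+1)\big(\psi(-2-p)\psi(n+1+p)+\psi(n-1-p)\psi(p)\big),$$ a sum with finitely many non-zero terms on each vector. (Equivalently $L(z)=V(\omega,z)$ with $\omega=\frac12\psi_{-3/2}\psi_{-1/2}\Omega$.) $\mathfrak{Vir}$ has basis $L_n$ ($n\in\mathbb Z$) and a central $C$, with $[L_m,L_n]=(m-n)L_{m+n}+\frac C{12}m(m^2-1)\delta_{m+n,0}$, $L_n^\star=L_{-n}$.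 $L(c,h)$ is here the irreducible highest weight representation of $\mathfrak{Vir}$: the quotient by its maximal proper submodule (the kernel of the canonical sesquilinear form) of the Verma module generated by a vector with $L_0$-eigenvalue $h$, $C$-eigenvalue $c$, annihilated by $L_n$, $n>0$. *)

theory Defs
  imports Complex_Main "HOL-Library.Poly_Mapping"
begin

section \<open>Free associative algebras and left ideals\<close>

text \<open>
  With lists as the free monoid under concatenation, the convolution product of
  \<^theory>\<open>HOL-Library.Poly_Mapping\<close> turns \<open>'g list \<Rightarrow>\<^sub>0 complex\<close> into the free unital
  associative complex algebra on the generators \<open>'g\<close>.
\<close>

instantiation list :: (type) monoid_add
begin
definition zero_list :: "'a list" where "zero_list = []"
definition plus_list :: "'a list \<Rightarrow> 'a list \<Rightarrow> 'a list" where "plus_list = (@)"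
instance by standard (auto simp: zero_list_def plus_list_def)
end

type_synonym 'g free_algebra = "'g list \<Rightarrow>\<^sub>0 complex"

definition gen :: "'g \<Rightarrow> 'g free_algebra" where
  "gen g = Poly_Mapping.single [g] 1"

definition scalar :: "complex \<Rightarrow> 'g free_algebra" where
  "scalar k = Poly_Mapping.single [] k"

definition left_ideal :: "'a::ring_1 set \<Rightarrow> bool" where
  "left_ideal J \<longleftrightarrow> 0 \<in> J \<and> (\<forall>x\<in>J. \<forall>y\<in>J. x + y \<in> J) \<and> (\<forall>a. \<forall>x\<in>J. a * x \<in> J)"

text \<open>
  Let \<open>A\<close> be the algebra with generators \<open>'g\<close> and relations \<open>r = 0\<close> for \<open>r \<in> R\<close>. The
  \<open>A\<close>-module freely generated by one vector \<open>v\<close> subject to \<open>s v = 0\<close> for \<open>s \<in> S\<close> is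
  the quotient of the free algebra by the following left ideal, \<open>v\<close> being the class of \<open>1\<close>.
\<close>

definition cyclic_ideal :: "'a::ring_1 set \<Rightarrow> 'a set \<Rightarrow> 'a set" where
  "cyclic_ideal R S = left_ideal hull ({r * b |r b. r \<in> R} \<union> S)"

lemma left_ideal_cyclic_ideal: "left_ideal (cyclic_ideal R S)"
  unfolding cyclic_ideal_def by (rule hull_in) (auto simp: left_ideal_def)

lemma left_ideal_diff:
  assumes "left_ideal J" "x \<in> J" "y \<in> J" shows "x - y \<in> J"
proof -
  have "(- 1) * y \<in> J" using assms unfolding left_ideal_def by blast
  with assms have "x + (- 1) * y \<in> J" unfolding left_ideal_def by blast
  then show ?thesis by simp
qed

section \<open>The fermion algebra and its module\<close>

text \<open>\<open>Psi n\<close> stands for \<open>\<psi>(n) = \<psi>\<^bsub>n+1/2\<^esub>\<close>, so that \<open>\<psi>\<^bsub>m\<^esub>\<close> with \<open>m > 0\<close> is \<open>Psi n\<close> with \<open>n \<ge> 0\<close>,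
  and \<open>\<delta>\<close> of the sum of the half-integer indices is the condition \<open>m + n + 1 = 0\<close>.\<close>

datatype fermion_gen = Psi int | Unit

definition fermion_relations :: "fermion_gen free_algebra set" where
  "fermion_relations =
     {gen (Psi m) * gen (Psi n) + gen (Psi n) * gen (Psi m)
        - (if m + n + 1 = 0 then gen Unit else 0) |m n. True}
     \<union> {gen Unit * gen (Psi n) - gen (Psi n) * gen Unit |n. True}"

definition fns_ideal :: "fermion_gen free_algebra set" where
  "fns_ideal = cyclic_ideal fermion_relations ({gen (Psi n) |n. n \<ge> 0} \<union> {gen Unit - 1})"

lemma left_ideal_fns_ideal: "left_ideal fns_ideal"
  unfolding fns_ideal_def by (rule left_ideal_cyclic_ideal)

lemma fns_ideal_zero: "0 \<in> fns_ideal"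
  and fns_ideal_add: "x \<in> fns_ideal \<Longrightarrow> y \<in> fns_ideal \<Longrightarrow> x + y \<in> fns_ideal"
  and fns_ideal_mult: "x \<in> fns_ideal \<Longrightarrow> a * x \<in> fns_ideal"
  and fns_ideal_diff: "x \<in> fns_ideal \<Longrightarrow> y \<in> fns_ideal \<Longrightarrow> x - y \<in> fns_ideal"
  using left_ideal_fns_ideal left_ideal_diff by (auto simp: left_ideal_def)

quotient_type fns = "fermion_gen free_algebra" / "\<lambda>a b. a - b \<in> fns_ideal"
proof (rule equivpI)
  show "reflp (\<lambda>a b. a - b \<in> fns_ideal)"
    by (simp add: reflp_def fns_ideal_zero)
  show "symp (\<lambda>a b. a - b \<in> fns_ideal)"
    using fns_ideal_diff[OF fns_ideal_zero] by (fastforce simp: symp_def)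
  show "transp (\<lambda>a b. a - b \<in> fns_ideal)"
    using fns_ideal_add by (fastforce simp: transp_def)
qed

instantiation fns :: ab_group_add
begin

lift_definition zero_fns :: fns is 0 .

lift_definition plus_fns :: "fns \<Rightarrow> fns \<Rightarrow> fns" is "(+)"
  using fns_ideal_add by (simp add: add_diff_add)

lift_definition minus_fns :: "fns \<Rightarrow> fns \<Rightarrow> fns" is "(-)"
  proof -
  fix a b c d :: "fermion_gen free_algebra"
  assume "a - b \<in> fns_ideal" "c - d \<in> fns_ideal"
  then have "(a - b) - (c - d) \<in> fns_ideal" by (rule fns_ideal_diff)
  then show "(a - c) - (b - d) \<in> fns_ideal" by (simp add: algebra_simps)
qed

lift_definition uminus_fns :: "fns \<Rightarrow> fns" is uminus
proof -
  fix a b :: "fermion_gen free_algebra"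
  assume "a - b \<in> fns_ideal"
  from fns_ideal_diff[OF fns_ideal_zero this] show "- a - (- b) \<in> fns_ideal" by simp
qed

instance
  by standard (transfer, simp add: fns_ideal_zero algebra_simps)+

end

definition fns_act :: "fermion_gen free_algebra \<Rightarrow> fns \<Rightarrow> fns" where
  "fns_act a v = abs_fns (a * rep_fns v)"

lemma fns_act_abs: "fns_act a (abs_fns x) = abs_fns (a * x)"
proof -
  have "rep_fns (abs_fns x) - x \<in> fns_ideal"
    using Quotient_rep_abs[OF Quotient_fns, of x] by (simp add: fns_ideal_zero)
  then show ?thesis
    using fns_ideal_mult[of _ a] by (simp add: fns_act_def fns.abs_eq_iff flip: right_diff_distrib)
qed

lift_definition fns_vacuum :: fns is 1 .

definition fns_scale :: "complex \<Rightarrow> fns \<Rightarrow> fns" where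
  "fns_scale k = fns_act (scalar k)"

lemma vector_space_fns: "vector_space fns_scale"
proof
  fix k l :: complex and u v :: fns
  obtain x y where [simp]: "u = abs_fns x" "v = abs_fns y"
    by (metis Quotient_abs_rep[OF Quotient_fns])
  show "fns_scale k (u + v) = fns_scale k u + fns_scale k v"
    by (simp add: fns_scale_def fns_act_abs plus_fns.abs_eq distrib_left)
  show "fns_scale (k + l) u = fns_scale k u + fns_scale l u"
    by (simp add: fns_scale_def fns_act_abs plus_fns.abs_eq scalar_def single_add distrib_right)
  show "fns_scale k (fns_scale l u) = fns_scale (k * l) u"
    by (simp add: fns_scale_def fns_act_abs scalar_def mult_single plus_list_def flip: mult.assoc)
  show "fns_scale 1 u = u"
    by (simp add: fns_scale_def fns_act_abs scalar_def flip: zero_list_def)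
qed

definition fns_psi :: "int \<Rightarrow> fns \<Rightarrow> fns" where
  "fns_psi n = fns_act (gen (Psi n))"

lemma fns_psi_anticommute:
  "fns_psi m (fns_psi n v) + fns_psi n (fns_psi m v)
     = (if m + n + 1 = 0 then fns_act (gen Unit) v else 0)"
proof -
  obtain x where v: "v = abs_fns x"
    by (metis Quotient_abs_rep[OF Quotient_fns])
  let ?r = "gen (Psi m) * gen (Psi n) + gen (Psi n) * gen (Psi m)
    - (if m + n + 1 = 0 then gen Unit else 0)"
  have "?r \<in> fermion_relations" unfolding fermion_relations_def by blast
  then have "?r * x \<in> fns_ideal"
    unfolding fns_ideal_def cyclic_ideal_def by (intro hull_inc) blast
  then show ?thesis
    by (simp add: v fns_psi_def fns_act_abs plus_fns.abs_eq zero_fns.abs_eq fns.abs_eq_iff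
        distrib_right left_diff_distrib mult.assoc split: if_splits)
qed

lemma fns_psi_vacuum: "n \<ge> 0 \<Longrightarrow> fns_psi n fns_vacuum = 0"
  and fns_Unit_vacuum: "fns_act (gen Unit) fns_vacuum = fns_vacuum"
proof -
  have S: "{gen (Psi n) |n. n \<ge> 0} \<union> {gen Unit - 1} \<subseteq> fns_ideal"
    unfolding fns_ideal_def cyclic_ideal_def
    by (rule order.trans[OF Un_upper2 hull_subset])
  show "fns_psi n fns_vacuum = 0" if "n \<ge> 0"
    using S that
    by (auto simp: fns_psi_def fns_vacuum.abs_eq fns_act_abs zero_fns.abs_eq fns.abs_eq_iff)
  show "fns_act (gen Unit) fns_vacuum = fns_vacuum"
    using S by (auto simp: fns_vacuum.abs_eq fns_act_abs fns.abs_eq_iff)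
qed

text \<open>\<^const>\<open>Sum_any\<close> is the sum over the indices whose summand is non-zero; here there are finitely
  many of them for every \<open>v\<close>.\<close>

definition fns_L :: "int \<Rightarrow> fns \<Rightarrow> fns" where
  "fns_L n v = fns_scale (1/2) (Sum_any (\<lambda>p::nat. fns_scale (of_nat (p + 1))
     (fns_psi (- 2 - int p) (fns_psi (n + 1 + int p) v)
      + fns_psi (n - 1 - int p) (fns_psi (int p) v))))"

section \<open>The Virasoro algebra and its representations\<close>

datatype vir_basis = VL int | VC

type_synonym vir = "vir_basis \<Rightarrow>\<^sub>0 complex"

definition vir_scale :: "complex \<Rightarrow> vir \<Rightarrow> vir" where
  "vir_scale k = Poly_Mapping.map ((*) k)"

fun vir_basis_bracket :: "vir_basis \<Rightarrow> vir_basis \<Rightarrow> vir" where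
  "vir_basis_bracket (VL m) (VL n) =
     Poly_Mapping.single (VL (m + n)) (of_int (m - n))
     + (if m + n = 0 then Poly_Mapping.single VC (of_int (m * (m\<^sup>2 - 1)) / 12) else 0)"
| "vir_basis_bracket VC _ = 0"
| "vir_basis_bracket (VL _) VC = 0"

definition vir_bracket :: "vir \<Rightarrow> vir \<Rightarrow> vir" where
  "vir_bracket x y = (\<Sum>a\<in>Poly_Mapping.keys x. \<Sum>b\<in>Poly_Mapping.keys y.
     vir_scale (Poly_Mapping.lookup x a * Poly_Mapping.lookup y b) (vir_basis_bracket a b))"

definition vir_representation ::
    "(complex \<Rightarrow> 'v::ab_group_add \<Rightarrow> 'v) \<Rightarrow> (vir \<Rightarrow> 'v \<Rightarrow> 'v) \<Rightarrow> bool" where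
  "vir_representation scale \<rho> \<longleftrightarrow>
     (\<forall>x. Vector_Spaces.linear scale scale (\<rho> x)) \<and>
     (\<forall>v. Vector_Spaces.linear vir_scale scale (\<lambda>x. \<rho> x v)) \<and>
     (\<forall>x y v. \<rho> (vir_bracket x y) v = \<rho> x (\<rho> y v) - \<rho> y (\<rho> x v))"

text \<open>Submodules and quotients do not live on a whole type; the following record carries the
  operations of a \<open>Vir\<close>-module on an explicit carrier.\<close>

record 'v vir_module =
  vm_carrier :: "'v set"
  vm_add :: "'v \<Rightarrow> 'v \<Rightarrow> 'v"
  vm_scale :: "complex \<Rightarrow> 'v \<Rightarrow> 'v"
  vm_act :: "vir \<Rightarrow> 'v \<Rightarrow> 'v"

definition vir_submodule :: "'v vir_module \<Rightarrow> 'v set \<Rightarrow> bool" where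
  "vir_submodule M N \<longleftrightarrow> N \<subseteq> vm_carrier M \<and> N \<noteq> {} \<and>
     (\<forall>x\<in>N. \<forall>y\<in>N. vm_add M x y \<in> N) \<and>
     (\<forall>k. \<forall>x\<in>N. vm_scale M k x \<in> N) \<and>
     (\<forall>g. \<forall>x\<in>N. vm_act M g x \<in> N)"

definition generated_submodule :: "'v vir_module \<Rightarrow> 'v \<Rightarrow> 'v vir_module" where
  "generated_submodule M v = M\<lparr>vm_carrier := vir_submodule M hull {v}\<rparr>"

definition coset :: "'v vir_module \<Rightarrow> 'v set \<Rightarrow> 'v \<Rightarrow> 'v set" where
  "coset M N x = vm_add M x ` N"

definition quotient_module :: "'v vir_module \<Rightarrow> 'v set \<Rightarrow> 'v set vir_module" where
  "quotient_module M N =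
     \<lparr>vm_carrier = coset M N ` vm_carrier M,
      vm_add = (\<lambda>X Y. \<Union>x\<in>X. \<Union>y\<in>Y. coset M N (vm_add M x y)),
      vm_scale = (\<lambda>k X. \<Union>x\<in>X. coset M N (vm_scale M k x)),
      vm_act = (\<lambda>g X. \<Union>x\<in>X. coset M N (vm_act M g x))\<rparr>"

definition vir_isomorphic :: "'v vir_module \<Rightarrow> 'w vir_module \<Rightarrow> bool" where
  "vir_isomorphic M M' \<longleftrightarrow> (\<exists>f. bij_betw f (vm_carrier M) (vm_carrier M') \<and>
     (\<forall>x\<in>vm_carrier M. \<forall>y\<in>vm_carrier M. f (vm_add M x y) = vm_add M' (f x) (f y)) \<and>
     (\<forall>k. \<forall>x\<in>vm_carrier M. f (vm_scale M k x) = vm_scale M' k (f x)) \<and>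
     (\<forall>g. \<forall>x\<in>vm_carrier M. f (vm_act M g x) = vm_act M' g (f x)))"

definition maximal_proper_submodule :: "'v vir_module \<Rightarrow> 'v set \<Rightarrow> bool" where
  "maximal_proper_submodule M N \<longleftrightarrow> vir_submodule M N \<and> N \<noteq> vm_carrier M \<and>
     (\<forall>N'. vir_submodule M N' \<and> N' \<noteq> vm_carrier M \<and> N \<subseteq> N' \<longrightarrow> N' = N)"

section \<open>Verma modules and their irreducible quotients\<close>

definition vir_embed :: "vir \<Rightarrow> vir_basis free_algebra" where
  "vir_embed x = (\<Sum>a\<in>Poly_Mapping.keys x. scalar (Poly_Mapping.lookup x a) * gen a)"

text \<open>The relations of the universal enveloping algebra.\<close>

definition vir_relations :: "vir_basis free_algebra set" where
  "vir_relations = {vir_embed x * vir_embed y - vir_embed y * vir_embed x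
     - vir_embed (vir_bracket x y) |x y. True}"

definition verma_ideal :: "complex \<Rightarrow> complex \<Rightarrow> vir_basis free_algebra set" where
  "verma_ideal c h = cyclic_ideal vir_relations
     ({gen (VL n) |n. n > 0} \<union> {gen (VL 0) - scalar h, gen VC - scalar c})"

text \<open>The free algebra itself is not a \<open>Vir\<close>-module, but its quotient by \<^const>\<open>verma_ideal\<close> is.\<close>

definition verma_module :: "complex \<Rightarrow> complex \<Rightarrow> vir_basis free_algebra set vir_module" where
  "verma_module c h = quotient_module
     \<lparr>vm_carrier = UNIV, vm_add = (+), vm_scale = (\<lambda>k a. scalar k * a),
      vm_act = (\<lambda>g a. vir_embed g * a)\<rparr>
     (verma_ideal c h)"

definition irreducible_module ::
    "complex \<Rightarrow> complex \<Rightarrow> vir_basis free_algebra set set vir_module" where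
  "irreducible_module c h = quotient_module (verma_module c h)
     (THE N. maximal_proper_submodule (verma_module c h) N)"

definition fns_vir_module :: "(vir \<Rightarrow> fns \<Rightarrow> fns) \<Rightarrow> fns vir_module" where
  "fns_vir_module \<rho> =
     \<lparr>vm_carrier = UNIV, vm_add = (+), vm_scale = fns_scale, vm_act = \<rho>\<rparr>"

end

(*
The module F_NS is identified with the fermionic Fock space, which makes the hermitian form
positive definite with psi(n)* = psi(-1-n). The operators satisfy
  [L_m, psi(k)] = -(k + 1/2 + m/2) psi(m+k),
so [L_m, L_n] - (m-n) L_(m+n) commutes with all psi and is a scalar, read off from the vacuum
coefficient of L_m L_n Omega; this gives c = 1/2. The same commutation rule yields L_n* = L_(-n).

Evaluation at Omega maps the Verma module onto the submodule generated by Omega. Let N be a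
submodule of the Verma module containing some x whose evaluation u is non-zero. Writing u = a Omega,
the vector a* u has vacuum coefficient (u, u), which is non-zero; since the weight-0 space of the
Verma module is spanned by its highest weight vector, a polynomial in L_0 turns a* x into a non-zero
multiple of that vector, so N is everything. Hence the kernel of the evaluation is the greatest proper
submodule.
*)
theory Submission
  imports Defs "HOL-Library.Function_Algebras"
begin

text \<open>\<open>fns\<close> is a quotient by a left ideal, so nothing in it is known in advance
  to be non-zero. An injective map into an explicit model repairs this, and its image need not be
  determined. The Verma module needs no such model: a spanning set of words, neither ordered nor
  shown to be independent, suffices, so the Poincare-Birkhoff-Witt theorem is avoided. Its
  sesquilinear form is not constructed either; the definite form on \<open>fns\<close>, seen through
  evaluation, does that work. Each L_n is an infinite sum that is finite only vector by vector. It
  is expanded once, against a single psi and on Omega, and two such sums are never multiplied. The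
  value c = 1/2 has this source: for m > 0 the vacuum coefficient of L_m L_(-m) Omega is half the
  sum of (p + 1)(p + 3/2 - m/2) over p < m - 1. That sum is m(m^2 - 1)/12, so the central term is
  m(m^2 - 1)/24.\<close>

lemma poly_mapping_induct [case_names single sum]:
  fixes x :: "'k \<Rightarrow>\<^sub>0 'c::comm_monoid_add"
  assumes "\<And>k v. P (Poly_Mapping.single k v)" "\<And>f g. P f \<Longrightarrow> P g \<Longrightarrow> P (f + g)"
  shows "P x"
proof (induction x rule: update_induct)
  case const
  then show ?case using assms(1)[of undefined 0] by simp
next
  case (update f a b)
  then have "Poly_Mapping.update a b f = f + Poly_Mapping.single a b"
    by (intro poly_mapping_eqI) (auto simp: lookup_update lookup_add lookup_single in_keys_iff)
  then show ?case using assms update by simp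
qed

section \<open>Free algebras and their actions by words of operators\<close>

lemma scalar_0 [simp]: "scalar 0 = 0" and scalar_1: "scalar 1 = 1"
  and scalar_add: "scalar (k + l) = scalar k + scalar l"
  and scalar_mult: "scalar (k * l) = scalar k * scalar l"
  by (simp_all add: scalar_def single_add mult_single plus_list_def)
    (simp flip: zero_list_def)

lemma scalar_diff: "scalar (k - l) = scalar k - scalar l"
  by (simp add: scalar_def single_diff)

lemma single_Cons: "Poly_Mapping.single (g # w) k = gen g * Poly_Mapping.single w k"
  by (simp add: gen_def mult_single plus_list_def)

lemma single_Nil: "Poly_Mapping.single [] k = scalar k * 1"
  by (simp add: scalar_def)

lemma scalar_commute: "scalar k * x = x * scalar k"
proof (induction x rule: poly_mapping_induct)
  case (single w l)
  then show ?case by (simp add: scalar_def mult_single plus_list_def mult.commute)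
next
  case (sum f g)
  then show ?case by (simp add: distrib_left distrib_right)
qed

lemma free_algebra_induct [case_names one scalar gen add]:
  assumes one: "P 1" and scalar: "\<And>k x. P x \<Longrightarrow> P (scalar k * x)"
    and gen: "\<And>g x. P x \<Longrightarrow> P (gen g * x)"
    and add: "\<And>x y. P x \<Longrightarrow> P y \<Longrightarrow> P (x + y)"
  shows "P x"
proof (induction x rule: poly_mapping_induct)
  case (single w k)
  show ?case
  proof (induction w)
    case Nil
    show ?case using scalar[OF one] by (simp add: single_Nil)
  next
    case (Cons g w)
    then show ?case using gen by (simp add: single_Cons)
  qed
qed (use add in auto)

text \<open>The universal property of the free algebra: linear operators chosen freely for the
  generators extend to an action. It is instantiated twice, by the fermions on the Fock space and by
  the Virasoro basis on \<open>fns\<close>.\<close>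

locale word_action = vector_space scale
  for scale :: "complex \<Rightarrow> 'v::ab_group_add \<Rightarrow> 'v" +
  fixes T :: "'g \<Rightarrow> 'v \<Rightarrow> 'v"
  assumes T_add: "T g (u + v) = T g u + T g v"
    and T_scale: "T g (scale k v) = scale k (T g v)"
begin

definition act :: "'g free_algebra \<Rightarrow> 'v \<Rightarrow> 'v" where
  "act a v = (\<Sum>w\<in>Poly_Mapping.keys a. scale (Poly_Mapping.lookup a w) (foldr T w v))"

lemma act_superset:
  assumes "finite S" "Poly_Mapping.keys a \<subseteq> S"
  shows "act a v = (\<Sum>w\<in>S. scale (Poly_Mapping.lookup a w) (foldr T w v))"
  unfolding act_def using assms
  by (intro sum.mono_neutral_left) (auto simp: in_keys_iff)

lemma act_add_left: "act (a + b) v = act a v + act b v"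
proof -
  let ?S = "Poly_Mapping.keys a \<union> Poly_Mapping.keys b"
  have "Poly_Mapping.keys (a + b) \<subseteq> ?S" by (rule Poly_Mapping.keys_add)
  then show ?thesis
    by (simp add: act_superset[of ?S] lookup_add scale_left_distrib sum.distrib)
qed

lemma act_single: "act (Poly_Mapping.single w k) v = scale k (foldr T w v)"
  by (cases "k = 0") (simp_all add: act_def)

lemma act_zero_left [simp]: "act 0 v = 0"
  by (simp add: act_def)

lemma act_diff_left: "act (a - b) v = act a v - act b v"
  using act_add_left[of "a - b" b v] by (simp add: algebra_simps)

lemma foldr_T_add: "foldr T w (u + v) = foldr T w u + foldr T w v"
  by (induction w) (auto simp: T_add)

lemma foldr_T_scale: "foldr T w (scale k v) = scale k (foldr T w v)"
  by (induction w) (auto simp: T_scale)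

lemma act_add_right: "act a (u + v) = act a u + act a v"
  by (simp add: act_def foldr_T_add scale_right_distrib sum.distrib)

lemma act_scale_right: "act a (scale k v) = scale k (act a v)"
  by (simp add: act_def foldr_T_scale scale_sum_right mult.commute)

lemma act_mult: "act (a * b) v = act a (act b v)"
proof (induction a rule: poly_mapping_induct)
  case (single w k)
  show ?case
  proof (induction b rule: poly_mapping_induct)
    case (single w' l)
    show ?case
      by (simp add: mult_single act_single plus_list_def foldr_T_scale)
  next
    case (sum f g)
    then show ?case by (simp add: distrib_left act_add_left act_add_right)
  qed
next
  case (sum f g)
  then show ?case by (simp add: distrib_right act_add_left)
qed

lemma act_gen [simp]: "act (gen g) v = T g v"
  by (simp add: gen_def act_single)

lemma act_scalar [simp]: "act (scalar k) v = scale k v"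
  by (simp add: scalar_def act_single)

lemma act_one [simp]: "act 1 v = v"
  using act_scalar[of 1 v] by (simp add: scalar_1)

lemma left_ideal_annihilator: "left_ideal {a. act a v = 0}"
  using act_add_right[of _ 0 0] by (auto simp: left_ideal_def act_add_left act_mult)

text \<open>The annihilator of \<open>v\<close> is a left ideal, so only the generators of the ideal
  need checking. The relations \<open>R\<close> must vanish on every vector because they occur as
  \<open>r * b\<close>, which sends \<open>v\<close> to r(b v); the conditions \<open>S\<close>
  concern \<open>v\<close> alone.\<close>

lemma cyclic_ideal_annihilates:
  assumes "\<And>r u. r \<in> R \<Longrightarrow> act r u = 0" "\<And>s. s \<in> S \<Longrightarrow> act s v = 0"
    and "x \<in> cyclic_ideal R S"
  shows "act x v = 0"
proof -
  have "cyclic_ideal R S \<subseteq> {a. act a v = 0}"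
    unfolding cyclic_ideal_def using assms(1,2)
    by (intro hull_minimal left_ideal_annihilator) (auto simp: act_mult)
  with assms(3) show ?thesis by auto
qed

end

section \<open>The operators on the fermion module and its spanning by creation operators\<close>

interpretation fns: vector_space fns_scale
  by (rule vector_space_fns)

lemma abs_fns_exhaust: "\<exists>x. v = abs_fns x"
  by (metis Quotient_abs_rep[OF Quotient_fns])

lemma fns_act_mult: "fns_act (a * b) v = fns_act a (fns_act b v)"
  using abs_fns_exhaust[of v] by (auto simp: fns_act_abs mult.assoc)

lemma fns_act_add_left: "fns_act (a + b) v = fns_act a v + fns_act b v"
  using abs_fns_exhaust[of v] by (auto simp: fns_act_abs plus_fns.abs_eq distrib_right)

lemma fns_act_add_right: "fns_act a (u + v) = fns_act a u + fns_act a v"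
  using abs_fns_exhaust[of v] abs_fns_exhaust[of u]
  by (auto simp: fns_act_abs plus_fns.abs_eq distrib_left)

lemma fns_act_scale: "fns_act a (fns_scale k v) = fns_scale k (fns_act a v)"
  unfolding fns_scale_def by (metis fns_act_mult scalar_commute)

lemma abs_fns_act_vacuum: "abs_fns x = fns_act x fns_vacuum"
  by (simp add: fns_vacuum.abs_eq fns_act_abs)

lemma fns_psi_add [simp]: "fns_psi n (u + v) = fns_psi n u + fns_psi n v"
  by (simp add: fns_psi_def fns_act_add_right)

lemma fns_psi_scale [simp]: "fns_psi n (fns_scale k v) = fns_scale k (fns_psi n v)"
  by (simp add: fns_psi_def fns_act_scale)

lemma fns_psi_zero [simp]: "fns_psi n 0 = 0"
  using fns_psi_scale[of n 0 0] by simp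

lemma fns_psi_minus [simp]: "fns_psi n (- u) = - fns_psi n u"
  using fns_psi_add[of n u "- u"] by (simp add: eq_neg_iff_add_eq_0 add.commute)

lemma fns_psi_diff [simp]: "fns_psi n (u - v) = fns_psi n u - fns_psi n v"
  using fns_psi_add[of n u "- v"] by simp

lemma fns_psi_sum: "fns_psi n (\<Sum>i\<in>S. g i) = (\<Sum>i\<in>S. fns_psi n (g i))"
  by (induction S rule: infinite_finite_induct) auto

lemma fns_generator_induct [case_names vacuum scale psi Unit add]:
  assumes "P fns_vacuum" "\<And>k v. P v \<Longrightarrow> P (fns_scale k v)" "\<And>n v. P v \<Longrightarrow> P (fns_psi n v)"
    "\<And>v. P v \<Longrightarrow> P (fns_act (gen Unit) v)" "\<And>u v. P u \<Longrightarrow> P v \<Longrightarrow> P (u + v)"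
  shows "P v"
proof -
  have "P (fns_act x fns_vacuum)" for x
  proof (induction x rule: free_algebra_induct)
    case one
    show ?case using assms(1) by (simp add: fns_vacuum.abs_eq fns_act_abs)
  next
    case (scalar k x)
    then show ?case using assms(2) by (simp add: fns_act_mult flip: fns_scale_def)
  next
    case (gen g x)
    then show ?case using assms(3,4) by (cases g) (simp_all add: fns_act_mult fns_psi_def)
  next
    case (add x y)
    then show ?case using assms(5) by (simp add: fns_act_add_left)
  qed
  then show ?thesis using abs_fns_exhaust[of v] by (auto simp: abs_fns_act_vacuum)
qed

text \<open>Centrality carries the identity from the vacuum, where it is imposed, to the whole
  cyclic module.\<close>

lemma fns_Unit [simp]: "fns_act (gen Unit) v = v"
proof (induction v rule: fns_generator_induct)
  case (psi n v)
  obtain x where v: "v = abs_fns x" using abs_fns_exhaust by blast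
  have "gen Unit * gen (Psi n) - gen (Psi n) * gen Unit \<in> fermion_relations"
    unfolding fermion_relations_def by blast
  then have "(gen Unit * gen (Psi n) - gen (Psi n) * gen Unit) * x \<in> fns_ideal"
    unfolding fns_ideal_def cyclic_ideal_def by (intro hull_inc) blast
  then have "fns_act (gen Unit) (fns_psi n v) = fns_psi n (fns_act (gen Unit) v)"
    by (simp add: v fns_psi_def fns_act_abs fns.abs_eq_iff left_diff_distrib mult.assoc)
  then show ?case using psi by simp
qed (simp_all add: fns_Unit_vacuum fns_act_scale fns_act_add_right)

lemma fns_psi_swap:
  "fns_psi m (fns_psi n v) = (if m + n + 1 = 0 then v else 0) - fns_psi n (fns_psi m v)"
  using fns_psi_anticommute[of m n v] by (auto simp: algebra_simps eq_neg_iff_add_eq_0 split: if_splits)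

lemma fns_psi_square: "fns_psi n (fns_psi n v) = 0"
proof -
  \<comment> \<open>The index n + 1/2 is a half-integer, hence never its own negative.\<close>
  have "n + n + 1 \<noteq> 0" by presburger
  then have "fns_scale 2 (fns_psi n (fns_psi n v)) = 0"
    using fns_psi_anticommute[of n n v] fns.scale_left_distrib[of 1 1 "fns_psi n (fns_psi n v)"]
    by simp
  then show ?thesis by simp
qed

text \<open>An auxiliary set for the sharper induction \<open>fns_induct\<close>, in which only
  creation operators occur. The point to prove is that annihilation operators preserve it: they move
  right until they reach the vacuum.\<close>

inductive_set creation_span :: "fns set" where
  vacuum: "fns_vacuum \<in> creation_span"
| scale: "v \<in> creation_span \<Longrightarrow> fns_scale k v \<in> creation_span"
| add: "u \<in> creation_span \<Longrightarrow> v \<in> creation_span \<Longrightarrow> u + v \<in> creation_span"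
| psi: "v \<in> creation_span \<Longrightarrow> n < 0 \<Longrightarrow> fns_psi n v \<in> creation_span"

lemma creation_span_zero: "0 \<in> creation_span"
  using creation_span.scale[OF creation_span.vacuum, of 0] by simp

lemma creation_span_diff: "u \<in> creation_span \<Longrightarrow> v \<in> creation_span \<Longrightarrow> u - v \<in> creation_span"
  using creation_span.add[OF _ creation_span.scale[of v "-1"]] by simp

lemma creation_span_annihilation:
  assumes "v \<in> creation_span" "n \<ge> 0"
  shows "fns_psi n v \<in> creation_span"
  using assms(1)
proof induction
  case (psi v m)
  then have "fns_psi m (fns_psi n v) \<in> creation_span"
    by (auto intro: creation_span.psi)
  then show ?case
    using psi.hyps(1) creation_span_zero
    by (simp add: fns_psi_swap[of n m v] creation_span_diff)
qed (use assms(2) in \<open>auto simp: fns_psi_vacuum creation_span_zero intro: creation_span.intros\<close>)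

lemma fns_induct [case_names vacuum scale add psi]:
  assumes "P fns_vacuum" "\<And>k v. P v \<Longrightarrow> P (fns_scale k v)" "\<And>u v. P u \<Longrightarrow> P v \<Longrightarrow> P (u + v)"
    "\<And>n v. P v \<Longrightarrow> n < 0 \<Longrightarrow> P (fns_psi n v)"
  shows "P v"
proof -
  have "v \<in> creation_span"
  proof (induction v rule: fns_generator_induct)
    case (psi n v)
    then show ?case
      by (cases "n < 0") (auto intro: creation_span.psi creation_span_annihilation)
  qed (auto intro: creation_span.intros)
  then show ?thesis by induction (use assms in auto)
qed

section \<open>The fermionic Fock space\<close>

type_synonym fock = "nat set \<Rightarrow> complex"

definition fock_scale :: "complex \<Rightarrow> fock \<Rightarrow> fock" where
  "fock_scale k f = (\<lambda>A. k * f A)"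

text \<open>The value of a state at \<open>A\<close> is the coefficient of \<open>\<psi>(-1-k\<^sub>1) \<cdots> \<psi>(-1-k\<^sub>r) \<Omega>\<close> with
  \<open>A = {k\<^sub>1 < \<dots> < k\<^sub>r}\<close>. Finite support is not imposed: it only matters for the image of \<open>fns\<close>.\<close>

definition inversion_sign :: "nat \<Rightarrow> nat set \<Rightarrow> complex" where
  "inversion_sign k A = (- 1) ^ card {j \<in> A. j < k}"

text \<open>Operators act on coefficients, so annihilating a mode reads the coefficient of the
  larger set and creating it that of the smaller one. The sign counts the factors of smaller label
  that psi passes on the way to its place in the increasing word.\<close>

definition fock_psi :: "int \<Rightarrow> fock \<Rightarrow> fock" where
  "fock_psi n f = (\<lambda>A.
     if n \<ge> 0 then if nat n \<in> A then 0 else inversion_sign (nat n) A * f (insert (nat n) A)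
     else if nat (- 1 - n) \<in> A then inversion_sign (nat (- 1 - n)) A * f (A - {nat (- 1 - n)})
     else 0)"

definition fock_vacuum :: fock where
  "fock_vacuum A = (if A = {} then 1 else 0)"

fun fock_gen :: "fermion_gen \<Rightarrow> fock \<Rightarrow> fock" where
  "fock_gen (Psi n) = fock_psi n"
| "fock_gen Unit = (\<lambda>f. f)"

lemma fock_psi_add: "fock_psi n (f + g) = fock_psi n f + fock_psi n g"
  by (rule ext) (simp add: fock_psi_def distrib_left)

lemma fock_psi_scale: "fock_psi n (fock_scale k f) = fock_scale k (fock_psi n f)"
  by (rule ext) (simp add: fock_psi_def fock_scale_def)

interpretation fock: word_action fock_scale fock_gen
proof
  fix g and k :: complex and u v :: fock
  show "fock_gen g (u + v) = fock_gen g u + fock_gen g v"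
    by (cases g) (simp_all add: fock_psi_add)
  show "fock_gen g (fock_scale k v) = fock_scale k (fock_gen g v)"
    by (cases g) (simp_all add: fock_psi_scale)
qed (auto simp: fock_scale_def algebra_simps fun_eq_iff)

lemma inversion_sign_square: "inversion_sign k A * inversion_sign k A = 1"
  by (simp add: inversion_sign_def flip: power_add)

lemma inversion_sign_insert:
  "inversion_sign k (insert j A) = (if j < k \<and> j \<notin> A then - 1 else 1) * inversion_sign k A"
proof (cases "j < k \<and> j \<notin> A")
  case True
  then have "{i \<in> insert j A. i < k} = insert j {i \<in> A. i < k}" by auto
  with True show ?thesis by (simp add: inversion_sign_def)
next
  case False
  then have "{i \<in> insert j A. i < k} = {i \<in> A. i < k}" by auto
  with False show ?thesis by (auto simp: inversion_sign_def)
qed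

lemma inversion_sign_remove:
  "inversion_sign k (A - {j}) = (if j < k \<and> j \<in> A then - 1 else 1) * inversion_sign k A"
  using inversion_sign_insert[of k j "A - {j}"] by (cases "j \<in> A") (auto simp: insert_absorb)

lemma insert_remove_swap: "j \<noteq> k \<Longrightarrow> insert j (A - {k}) = insert j A - {k}"
  by auto

text \<open>For two different modes, exactly one of the two orders sees its sign changed by the
  other operator, so the terms cancel. For a creation and an annihilation of the same mode, exactly
  one order survives at each \<open>A\<close> and its signs square to 1.\<close>

lemma fock_psi_anticommute:
  "fock_psi m (fock_psi n f) + fock_psi n (fock_psi m f) = (if m + n + 1 = 0 then f else 0)"
proof (rule ext)
  fix A
  have minus: "nat m = nat (- 1 - n) \<longleftrightarrow> m + n + 1 = 0" if "m \<ge> 0" "n < 0" for m n :: int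
    using that by auto
  consider "m \<ge> 0" "n \<ge> 0" | "m < 0" "n < 0" | "m \<ge> 0" "n < 0" | "m < 0" "n \<ge> 0"
    by linarith
  then show "(fock_psi m (fock_psi n f) + fock_psi n (fock_psi m f)) A
      = (if m + n + 1 = 0 then f else 0) A"
  proof cases
    case 1
    then show ?thesis
      by (auto simp: fock_psi_def inversion_sign_insert insert_commute)
  next
    case 2
    then have "m + n + 1 \<noteq> 0" by linarith
    then show ?thesis using 2
      by (auto simp: fock_psi_def inversion_sign_remove insert_commute Diff_insert2[symmetric] Diff_insert[symmetric])
  next
    case 3
    then show ?thesis
      using minus[OF 3] inversion_sign_square[of "nat m" A]
      by (cases "m + n + 1 = 0") (auto simp: fock_psi_def inversion_sign_remove inversion_sign_insert insert_absorb insert_remove_swap)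
  next
    case 4
    then show ?thesis
      using minus[OF 4(2,1)] inversion_sign_square[of "nat n" A]
      by (cases "m + n + 1 = 0") (auto simp: fock_psi_def inversion_sign_remove inversion_sign_insert insert_absorb insert_remove_swap)
  qed
qed

definition fock_of :: "fns \<Rightarrow> fock" where
  "fock_of u = fock.act (rep_fns u) fock_vacuum"

text \<open>This makes \<open>fock_of\<close> independent of the representative.\<close>

lemma act_fns_ideal:
  assumes "x \<in> fns_ideal"
  shows "fock.act x fock_vacuum = 0"
proof (rule fock.cyclic_ideal_annihilates)
  show "x \<in> cyclic_ideal fermion_relations ({gen (Psi n) |n. n \<ge> 0} \<union> {gen Unit - 1})"
    using assms by (simp add: fns_ideal_def)
  show "fock.act r u = 0" if "r \<in> fermion_relations" for r u
    using that unfolding fermion_relations_def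
  proof (elim UnE CollectE exE conjE)
    fix m n
    assume "r = gen (Psi m) * gen (Psi n) + gen (Psi n) * gen (Psi m)
      - (if m + n + 1 = 0 then gen Unit else 0)"
    then show ?thesis
      using fock_psi_anticommute[of m n u]
      by (cases "m + n + 1 = 0") (simp_all add: fock.act_add_left fock.act_diff_left fock.act_mult)
  qed (simp add: fock.act_diff_left fock.act_mult)
  show "fock.act s fock_vacuum = 0" if "s \<in> {gen (Psi n) |n. n \<ge> 0} \<union> {gen Unit - 1}" for s
    using that
    by (auto simp: fock.act_diff_left fock_psi_def fock_vacuum_def fun_eq_iff)
qed

lemma fock_of_abs: "fock_of (abs_fns x) = fock.act x fock_vacuum"
proof -
  have "rep_fns (abs_fns x) - x \<in> fns_ideal"
    using Quotient_rep_abs[OF Quotient_fns, of x] by (simp add: fns_ideal_zero)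
  then show ?thesis
    using act_fns_ideal[of "rep_fns (abs_fns x) - x"] by (simp add: fock_of_def fock.act_diff_left)
qed

lemma fock_of_vacuum: "fock_of fns_vacuum = fock_vacuum"
  by (simp add: fns_vacuum.abs_eq fock_of_abs)

lemma fock_of_act: "fock_of (fns_act a u) = fock.act a (fock_of u)"
  using abs_fns_exhaust[of u] by (auto simp: fns_act_abs fock_of_abs fock.act_mult)

lemma fock_of_add: "fock_of (u + v) = fock_of u + fock_of v"
  using abs_fns_exhaust[of u] abs_fns_exhaust[of v]
  by (auto simp: plus_fns.abs_eq fock_of_abs fock.act_add_left)

lemma fock_of_scale: "fock_of (fns_scale k u) = fock_scale k (fock_of u)"
  by (simp add: fns_scale_def fock_of_act)

lemma fock_of_psi: "fock_of (fns_psi n u) = fock_psi n (fock_of u)"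
  by (simp add: fns_psi_def fock_of_act)

text \<open>Creating or annihilating mode \<open>k\<close> moves coefficients along this involution,
  so sums over all sets can be reindexed by a bijection instead of being split according to whether
  \<open>k\<close> is present.\<close>

definition toggle :: "nat \<Rightarrow> nat set \<Rightarrow> nat set" where
  "toggle k A = (if k \<in> A then A - {k} else insert k A)"

lemma toggle_toggle [simp]: "toggle k (toggle k A) = A"
  by (auto simp: toggle_def)

lemma bij_toggle: "bij (toggle k)"
  by (rule involuntory_imp_bij) simp

text \<open>Both halves guard against default values: \<open>Sum_any\<close> is 0 on an infinite
  support, and \<open>sorted_list_of_set\<close> is empty on an infinite set.\<close>

lemma fock_of_support: "finite {A. fock_of u A \<noteq> 0} \<and> (\<forall>A. fock_of u A \<noteq> 0 \<longrightarrow> finite A)"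
proof (induction u rule: fns_induct)
  case vacuum
  have "{A. fock_vacuum A \<noteq> 0} = {{}}" by (auto simp: fock_vacuum_def)
  then show ?case by (auto simp: fock_of_vacuum fock_vacuum_def)
next
  case (scale k v)
  then show ?case by (auto simp: fock_of_scale fock_scale_def elim: rev_finite_subset)
next
  case (add u v)
  have "{A. fock_of (u + v) A \<noteq> 0} \<subseteq> {A. fock_of u A \<noteq> 0} \<union> {A. fock_of v A \<noteq> 0}"
    by (auto simp: fock_of_add)
  with add show ?case
    by (auto simp: fock_of_add dest: finite_subset)
next
  case (psi n v)
  let ?k = "nat (- 1 - n)"
  have "{A. fock_of (fns_psi n v) A \<noteq> 0} \<subseteq> toggle ?k ` {A. fock_of v A \<noteq> 0}"
  proof
    fix A assume "A \<in> {A. fock_of (fns_psi n v) A \<noteq> 0}"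
    then have "fock_of v (toggle ?k A) \<noteq> 0"
      using psi by (auto simp: fock_of_psi fock_psi_def toggle_def split: if_splits)
    then show "A \<in> toggle ?k ` {A. fock_of v A \<noteq> 0}"
      by (intro image_eqI[of _ _ "toggle ?k A"]) auto
  qed
  moreover have "finite A" if "fock_of (fns_psi n v) A \<noteq> 0" for A
  proof -
    have "fock_of v (A - {?k}) \<noteq> 0"
      using psi(2) that by (auto simp: fock_of_psi fock_psi_def split: if_splits)
    with psi show ?thesis by (metis finite_Diff2 finite.emptyI finite.insertI)
  qed
  ultimately show ?case using psi by (auto dest: finite_subset)
qed

lemmas finite_fock_of = conjunct1[OF fock_of_support]

definition creation_word :: "nat list \<Rightarrow> fns" where
  "creation_word ks = foldr (\<lambda>k. fns_psi (- 1 - int k)) ks fns_vacuum"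

text \<open>One step of insertion sort: each smaller factor that is passed costs a sign, and meeting
  an equal factor gives a square, which is 0.\<close>

lemma creation_word_insort:
  assumes "sorted ks" "distinct ks"
  shows "fns_psi (- 1 - int k) (creation_word ks)
    = (if k \<in> set ks then 0
       else fns_scale (inversion_sign k (set ks)) (creation_word (insort k ks)))"
  using assms
proof (induction ks)
  case Nil
  then show ?case by (simp add: creation_word_def inversion_sign_def)
next
  case (Cons j ks)
  have swap: "fns_psi (- 1 - int k) (fns_psi (- 1 - int j) v)
    = - fns_psi (- 1 - int j) (fns_psi (- 1 - int k) v)" for v
    by (simp add: fns_psi_swap[of "- 1 - int k"])
  consider "k < j" | "k = j" | "k > j" by linarith
  then show ?case
  proof cases
    case 1
    with Cons have "{i \<in> set (j # ks). i < k} = {}" by auto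
    with 1 have "inversion_sign k (set (j # ks)) = 1"
      by (simp only: inversion_sign_def card.empty power_0)
    moreover from 1 Cons have "k \<notin> set (j # ks)" by auto
    ultimately show ?thesis using 1 by (simp add: creation_word_def)
  next
    case 2
    then show ?thesis by (simp add: creation_word_def fns_psi_square)
  next
    case 3
    then have "inversion_sign k (set (j # ks)) = - inversion_sign k (set ks)"
      using Cons.prems by (simp add: inversion_sign_insert)
    moreover have "fns_psi (- 1 - int k) (creation_word (j # ks))
        = - fns_psi (- 1 - int j) (fns_psi (- 1 - int k) (creation_word ks))"
      by (simp add: creation_word_def swap)
    ultimately show ?thesis using 3 Cons
      by (auto simp: creation_word_def)
  qed
qed

definition fock_inverse :: "fock \<Rightarrow> fns" where
  "fock_inverse f = Sum_any (\<lambda>A. fns_scale (f A) (creation_word (sorted_list_of_set A)))"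

text \<open>A left inverse shows that \<open>fock_of\<close> is injective, which is what makes the
  inner product pulled back from the model definite.\<close>

lemma fock_inverse_fock_of: "fock_inverse (fock_of u) = u"
proof (induction u rule: fns_induct)
  case vacuum
  have "(\<lambda>A. fns_scale (fock_of fns_vacuum A) (creation_word (sorted_list_of_set A)))
    = (\<lambda>A. if A = {} then fns_vacuum else 0)"
    by (auto simp: fock_of_vacuum fock_vacuum_def creation_word_def)
  then show ?case by (simp only: fock_inverse_def Sum_any.delta)
next
  case (scale k v)
  have "fock_inverse (fock_of (fns_scale k v)) = (\<Sum>A | fock_of v A \<noteq> 0.
      fns_scale (k * fock_of v A) (creation_word (sorted_list_of_set A)))"
    unfolding fock_inverse_def fock_of_scale fock_scale_def
    by (rule Sum_any.expand_superset[OF finite_fock_of]) auto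
  also have "\<dots> = fns_scale k (fock_inverse (fock_of v))"
    unfolding fock_inverse_def
    by (subst Sum_any.expand_superset[OF finite_fock_of[of v]]) (auto simp: fns.scale_sum_right)
  finally show ?case using scale by simp
next
  case (add u v)
  have "finite {A. fns_scale (fock_of u A) (creation_word (sorted_list_of_set A)) \<noteq> 0}" for u
    by (rule finite_subset[OF _ finite_fock_of[of u]]) auto
  then have "fock_inverse (fock_of (u + v)) = fock_inverse (fock_of u) + fock_inverse (fock_of v)"
    by (simp add: fock_inverse_def fock_of_add fns.scale_left_distrib Sum_any.distrib)
  with add show ?case by simp
next
  case (psi n v)
  define k where "k = nat (- 1 - n)"
  have n: "n = - 1 - int k" using psi(2) by (simp add: k_def)
  let ?g = "\<lambda>A. fns_scale (fock_of v A) (fns_psi n (creation_word (sorted_list_of_set A)))"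
  have "fock_inverse (fock_of (fns_psi n v)) = Sum_any ?g"
    unfolding fock_inverse_def
  \<comment> \<open>The coefficient of psi v at the toggled set comes from that of v at
    \<open>A\<close>. If \<open>k\<close> lies in \<open>A\<close>, both sides vanish: the toggled
    set lacks \<open>k\<close>, and the word would repeat a factor.\<close>
  proof (rule Sum_any.reindex_cong[OF bij_toggle[of k]], rule ext)
    fix A
    show "((\<lambda>A. fns_scale (fock_of (fns_psi n v) A) (creation_word (sorted_list_of_set A)))
        \<circ> toggle k) A = ?g A"
    proof (cases "finite A")
      case True
      then show ?thesis
        by (auto simp: fock_of_psi n creation_word_insort toggle_def fock_psi_def
            inversion_sign_insert sorted_list_of_set_insert_remove mult.commute)
    next
      case False
      then have "infinite (toggle k A)" by (auto simp: toggle_def)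
      with False show ?thesis using fock_of_support[of v] fock_of_support[of "fns_psi n v"]
        by (metis (no_types, lifting) comp_apply fns.scale_zero_left)
    qed
  qed
  also have "\<dots> = (\<Sum>A | fock_of v A \<noteq> 0. ?g A)"
    by (rule Sum_any.expand_superset[OF finite_fock_of]) auto
  also have "\<dots> = fns_psi n (fock_inverse (fock_of v))"
    unfolding fock_inverse_def
    by (subst Sum_any.expand_superset[OF finite_fock_of[of v]]) (auto simp: fns_psi_sum)
  finally show ?case using psi by simp
qed

section \<open>The inner product\<close>

definition fns_inner :: "fns \<Rightarrow> fns \<Rightarrow> complex" where
  "fns_inner u v = Sum_any (\<lambda>A. fock_of u A * cnj (fock_of v A))"

lemma finite_fns_inner: "finite {A. fock_of u A * cnj (fock_of v A) \<noteq> 0}"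
  by (rule finite_subset[OF _ finite_fock_of[of u]]) auto

lemma fns_inner_add_left: "fns_inner (u + v) w = fns_inner u w + fns_inner v w"
  unfolding fns_inner_def
  by (subst Sum_any.distrib[OF finite_fns_inner finite_fns_inner, symmetric])
    (simp add: fock_of_add distrib_right)

lemma fns_inner_cnj: "cnj (fns_inner u v) = fns_inner v u"
proof -
  have "fns_inner v u = (\<Sum>A | fock_of u A \<noteq> 0. fock_of v A * cnj (fock_of u A))"
    unfolding fns_inner_def by (rule Sum_any.expand_superset[OF finite_fock_of]) auto
  moreover have "fns_inner u v = (\<Sum>A | fock_of u A \<noteq> 0. fock_of u A * cnj (fock_of v A))"
    unfolding fns_inner_def by (rule Sum_any.expand_superset[OF finite_fock_of]) auto
  ultimately show ?thesis by (simp add: mult.commute)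
qed

lemma fns_inner_scale_left: "fns_inner (fns_scale k u) w = k * fns_inner u w"
  unfolding fns_inner_def
  by (subst Sum_any_right_distrib[OF finite_fns_inner])
    (simp add: fock_of_scale fock_scale_def mult.assoc)

lemma fns_inner_add_right: "fns_inner w (u + v) = fns_inner w u + fns_inner w v"
  by (metis complex_cnj_add fns_inner_add_left fns_inner_cnj)

lemma fns_inner_scale_right: "fns_inner w (fns_scale k u) = cnj k * fns_inner w u"
  by (metis complex_cnj_mult fns_inner_scale_left fns_inner_cnj)

lemma fns_inner_zero [simp]: "fns_inner 0 v = 0" "fns_inner v 0 = 0"
  using fns_inner_scale_left[of 0 0 v] fns_inner_scale_right[of v 0 0] by simp_all

lemma fns_inner_sum_left: "fns_inner (\<Sum>i\<in>S. g i) v = (\<Sum>i\<in>S. fns_inner (g i) v)"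
  by (induction S rule: infinite_finite_induct) (auto simp: fns_inner_add_left)

lemma fns_inner_minus_left: "fns_inner (- u) v = - fns_inner u v"
  using fns_inner_scale_left[of "- 1" u v] by simp

lemma fns_inner_diff_left: "fns_inner (u - v) w = fns_inner u w - fns_inner v w"
  using fns_inner_add_left[of u "- v" w] by (simp add: fns_inner_minus_left)

lemma fns_inner_diff_right: "fns_inner w (u - v) = fns_inner w u - fns_inner w v"
  by (metis complex_cnj_diff fns_inner_diff_left fns_inner_cnj)

lemma fns_inner_psi: "fns_inner (fns_psi n u) v = fns_inner u (fns_psi (- 1 - n) v)"
proof -
  have cnj_sign: "cnj (inversion_sign k A) = inversion_sign k A" for k A
    by (simp add: inversion_sign_def)
  have creation: "fns_inner (fns_psi n u) v = fns_inner u (fns_psi (- 1 - n) v)" if "n < 0" for n u v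
    unfolding fns_inner_def
  \<comment> \<open>After toggling, both summands vanish where the mode is present; elsewhere they
    carry the same sign, which is real. The case of an annihilation operator then follows by
    conjugate symmetry.\<close>
  proof (rule Sum_any.reindex_cong[OF bij_toggle[of "nat (- 1 - n)"]], rule ext)
    fix A
    show "((\<lambda>A. fock_of (fns_psi n u) A * cnj (fock_of v A)) \<circ> toggle (nat (- 1 - n))) A
        = fock_of u A * cnj (fock_of (fns_psi (- 1 - n) v) A)"
      using that
      by (auto simp: fock_of_psi fock_psi_def toggle_def inversion_sign_insert cnj_sign)
  qed
  show ?thesis
  proof (cases "n < 0")
    case True
    then show ?thesis by (rule creation)
  next
    case False
    then have "fns_inner (fns_psi (- 1 - n) v) u = fns_inner v (fns_psi n u)"
      using creation[of "- 1 - n" v u] by simp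
    then show ?thesis by (metis fns_inner_cnj)
  qed
qed

lemma fns_inner_self_eq_0:
  assumes "fns_inner u u = 0"
  shows "u = 0"
proof -
  have "fns_inner u u = (\<Sum>A | fock_of u A \<noteq> 0. of_real ((cmod (fock_of u A))\<^sup>2))"
    unfolding fns_inner_def complex_norm_square
    by (rule Sum_any.expand_superset[OF finite_fock_of]) auto
  then have "(\<Sum>A | fock_of u A \<noteq> 0. (cmod (fock_of u A))\<^sup>2) = 0"
    using assms by (metis of_real_eq_0_iff of_real_sum)
  then have "fock_of u A = 0" for A
    using finite_fock_of[of u] by (auto simp: sum_nonneg_eq_0_iff)
  then have "fock_inverse (fock_of u) = 0"
    by (simp add: fock_inverse_def)
  then show ?thesis by (simp add: fock_inverse_fock_of)
qed

lemma fns_inner_vacuum: "fns_inner fns_vacuum fns_vacuum = 1"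
proof -
  have "(\<lambda>A. fock_of fns_vacuum A * cnj (fock_of fns_vacuum A)) = (\<lambda>A. if A = {} then 1 else 0)"
    by (auto simp: fock_of_vacuum fock_vacuum_def)
  then show ?thesis by (simp only: fns_inner_def Sum_any.delta)
qed

lemma fns_vacuum_nonzero: "fns_vacuum \<noteq> 0"
  using fns_inner_vacuum fns_inner_scale_left[of 0 fns_vacuum fns_vacuum] by auto

text \<open>Subtracting the vacuum component leaves a vector orthogonal to the vacuum and, by
  adjointness, to everything of the form psi(n) v with n < 0. These span, and the form is
  definite.\<close>

lemma fns_annihilated:
  assumes "\<And>n. n \<ge> 0 \<Longrightarrow> fns_psi n w = 0"
  shows "w = fns_scale (fns_inner w fns_vacuum) fns_vacuum"
proof -
  define u where "u = w + fns_scale (- fns_inner w fns_vacuum) fns_vacuum"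
  have "fns_inner u v = 0" for v
  proof (induction v rule: fns_induct)
    case (psi n v)
    have "fns_psi (- 1 - n) u = 0"
      using psi(2) assms by (simp add: u_def fns_psi_vacuum)
    then show ?case using fns_inner_psi[of "- 1 - n" u v] by simp
  qed (auto simp: fns_inner_add_right fns_inner_scale_right u_def fns_inner_diff_left
      fns_inner_scale_left fns_inner_vacuum)
  then have "u = 0" by (intro fns_inner_self_eq_0)
  then show ?thesis by (simp add: u_def fns.scale_minus_left)
qed

section \<open>The Virasoro operators on the fermionic Fock space\<close>

definition L_term :: "int \<Rightarrow> nat \<Rightarrow> fns \<Rightarrow> fns" where
  "L_term n p v = fns_scale (of_nat (p + 1))
     (fns_psi (- 2 - int p) (fns_psi (n + 1 + int p) v)
      + fns_psi (n - 1 - int p) (fns_psi (int p) v))"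

lemma fns_psi_eventually_zero: "\<exists>N\<ge>0. \<forall>n\<ge>N. fns_psi n v = 0"
proof (induction v rule: fns_induct)
  case (add u v)
  then obtain M N where "\<forall>n\<ge>M. fns_psi n u = 0" "\<forall>n\<ge>N. fns_psi n v = 0" "M \<ge> 0" by blast
  then show ?case by (intro exI[of _ "max M N"]) auto
next
  case (psi m v)
  then obtain N where "\<forall>n\<ge>N. fns_psi n v = 0" by blast
  \<comment> \<open>Beyond \<bar>m\<bar> the anticommutator with psi(m) is 0, since it needs n = - m
    - 1.\<close>
  then show ?case by (intro exI[of _ "max N (\<bar>m\<bar> + 1)"]) (auto simp: fns_psi_swap[of _ m])
qed (auto intro: fns_psi_vacuum)

lemma fns_L_eventually:
  "\<exists>N. \<forall>M\<ge>N. fns_L n v = fns_scale (1/2) (\<Sum>p<M. L_term n p v)"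
proof -
  obtain N where N: "N \<ge> 0" "\<forall>n\<ge>N. fns_psi n v = 0" using fns_psi_eventually_zero by blast
  show ?thesis
  proof (intro exI allI impI)
    fix M assume M: "M \<ge> nat (N + \<bar>n\<bar>)"
    have "p < M" if "L_term n p v \<noteq> 0" for p
    proof (rule ccontr)
      assume "\<not> p < M"
      with N M have "fns_psi (n + 1 + int p) v = 0" "fns_psi (int p) v = 0" by auto
      with that show False by (simp add: L_term_def)
    qed
    then show "fns_L n v = fns_scale (1/2) (\<Sum>p<M. L_term n p v)"
      unfolding fns_L_def L_term_def[symmetric]
      by (subst Sum_any.expand_superset[of "{..<M}"]) auto
  qed
qed

text \<open>A single cutoff for several vectors lets identities between values of L_n be checked
  term by term; \<open>K\<close> leaves room for index positions that must lie below the
  cutoff.\<close>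

lemma fns_L_obtain:
  obtains M where "M \<ge> K" "fns_L n u = fns_scale (1/2) (\<Sum>p<M. L_term n p u)"
    "fns_L n v = fns_scale (1/2) (\<Sum>p<M. L_term n p v)"
    "fns_L n w = fns_scale (1/2) (\<Sum>p<M. L_term n p w)"
proof -
  obtain A B C where "\<forall>M\<ge>A. fns_L n u = fns_scale (1/2) (\<Sum>p<M. L_term n p u)"
    "\<forall>M\<ge>B. fns_L n v = fns_scale (1/2) (\<Sum>p<M. L_term n p v)"
    "\<forall>M\<ge>C. fns_L n w = fns_scale (1/2) (\<Sum>p<M. L_term n p w)"
    by (metis fns_L_eventually)
  then show ?thesis by (intro that[of "max K (max A (max B C))"]) auto
qed

lemma L_term_add: "L_term n p (u + v) = L_term n p u + L_term n p v"
  by (simp add: L_term_def fns.scale_right_distrib)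

lemma L_term_scale: "L_term n p (fns_scale k u) = fns_scale k (L_term n p u)"
  by (simp add: L_term_def fns.scale_right_distrib mult.commute)

lemma fns_L_add: "fns_L n (u + v) = fns_L n u + fns_L n v"
  by (rule fns_L_obtain[of 0 n u v "u + v"])
    (simp add: L_term_add sum.distrib fns.scale_right_distrib)

lemma fns_L_scale: "fns_L n (fns_scale k u) = fns_scale k (fns_L n u)"
  by (rule fns_L_obtain[of 0 n u u "fns_scale k u"])
    (simp add: L_term_scale mult.commute flip: fns.scale_sum_right)

text \<open>Passing psi(k) through both factors changes the sign twice, so only the two
  anticommutators remain.\<close>

lemma fns_psi_pair_commute:
  "fns_psi a (fns_psi b (fns_psi k v)) - fns_psi k (fns_psi a (fns_psi b v))
    = (if b + k + 1 = 0 then fns_psi a v else 0) - (if a + k + 1 = 0 then fns_psi b v else 0)"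
  by (simp add: fns_psi_swap[of b k] fns_psi_swap[of a k "fns_psi b v"])

lemma sum_delta_int:
  fixes g :: "int \<Rightarrow> complex"
  assumes "z < int M"
  shows "(\<Sum>p<M. if int p = z then g (int p) else 0) = (if z \<ge> 0 then g z else 0)"
proof (cases "z \<ge> 0")
  case True
  then have "(\<Sum>p<M. if int p = z then g (int p) else 0) = (\<Sum>p<M. if p = nat z then g z else 0)"
    by (intro sum.cong) auto
  then show ?thesis using True assms by (simp add: nat_less_iff)
next
  case False
  then have "(\<Sum>p<M. if int p = z then g (int p) else 0) = 0"
    by (intro sum.neutral) auto
  with False show ?thesis by simp
qed

text \<open>Each of the four possible contractions forces one value of \<open>p\<close>, and for
  that value the surviving factor is always psi(n + k).\<close>

lemma L_term_commute:
  "L_term n p (fns_psi k v) - fns_psi k (L_term n p v)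
   = fns_scale ((if int p = - n - 2 - k then of_int (int p + 1) else 0)
       - (if int p = k - 1 then of_int (int p + 1) else 0)
       + (if int p = - k - 1 then of_int (int p + 1) else 0)
       - (if int p = n + k then of_int (int p + 1) else 0)) (fns_psi (n + k) v)"
proof -
  let ?d = "\<lambda>z j. if int p = z then fns_psi j v else 0"
  have "L_term n p (fns_psi k v) - fns_psi k (L_term n p v) = fns_scale (of_nat (p + 1))
     ((fns_psi (- 2 - int p) (fns_psi (n + 1 + int p) (fns_psi k v))
        - fns_psi k (fns_psi (- 2 - int p) (fns_psi (n + 1 + int p) v)))
      + (fns_psi (n - 1 - int p) (fns_psi (int p) (fns_psi k v))
        - fns_psi k (fns_psi (n - 1 - int p) (fns_psi (int p) v))))"
    by (simp add: L_term_def fns.scale_right_distrib fns.scale_right_diff_distrib algebra_simps)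
  also have "\<dots> = fns_scale (of_nat (p + 1))
     ((?d (- n - 2 - k) (n + k) - ?d (k - 1) (n + k)) + (?d (- k - 1) (n + k) - ?d (n + k) (n + k)))"
  proof -
    have "(if n + 1 + int p + k + 1 = 0 then fns_psi (- 2 - int p) v else 0) = ?d (- n - 2 - k) (n + k)"
      by (auto intro!: arg_cong[of _ _ "\<lambda>j. fns_psi j v"])
    moreover have "(if - 2 - int p + k + 1 = 0 then fns_psi (n + 1 + int p) v else 0) = ?d (k - 1) (n + k)"
      by (auto intro!: arg_cong[of _ _ "\<lambda>j. fns_psi j v"])
    moreover have "(if int p + k + 1 = 0 then fns_psi (n - 1 - int p) v else 0) = ?d (- k - 1) (n + k)"
      by (auto intro!: arg_cong[of _ _ "\<lambda>j. fns_psi j v"])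
    moreover have "(if n - 1 - int p + k + 1 = 0 then fns_psi (int p) v else 0) = ?d (n + k) (n + k)"
      by (auto intro!: arg_cong[of _ _ "\<lambda>j. fns_psi j v"])
    ultimately show ?thesis unfolding fns_psi_pair_commute by simp
  qed
  also have "\<dots> = fns_scale ((if int p = - n - 2 - k then of_int (int p + 1) else 0)
       - (if int p = k - 1 then of_int (int p + 1) else 0)
       + (if int p = - k - 1 then of_int (int p + 1) else 0)
       - (if int p = n + k then of_int (int p + 1) else 0)) (fns_psi (n + k) v)"
  proof -
    have *: "fns_scale (of_nat (p + 1)) (if b then x else 0)
      = fns_scale (if b then of_int (int p + 1) else 0) x" for b x
      by simp
    show ?thesis
      unfolding fns.scale_right_distrib fns.scale_right_diff_distrib
        fns.scale_left_distrib fns.scale_left_diff_distrib * by simp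
  qed
  finally show ?thesis .
qed

lemma fns_L_psi:
  "fns_L n (fns_psi k v)
    = fns_psi k (fns_L n v) - fns_scale (of_int k + 1/2 + of_int n / 2) (fns_psi (n + k) v)"
proof -
  obtain M where M: "M \<ge> nat (\<bar>n\<bar> + \<bar>k\<bar> + 3)"
    "fns_L n v = fns_scale (1/2) (\<Sum>p<M. L_term n p v)"
    "fns_L n (fns_psi k v) = fns_scale (1/2) (\<Sum>p<M. L_term n p (fns_psi k v))"
    by (rule fns_L_obtain)
  let ?S = "\<lambda>z. \<Sum>p<M. if int p = z then of_int (int p + 1) else (0 :: complex)"
  have "fns_L n (fns_psi k v) - fns_psi k (fns_L n v)
      = fns_scale (1/2) (\<Sum>p<M. L_term n p (fns_psi k v) - fns_psi k (L_term n p v))"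
    by (simp add: M fns_psi_sum sum_subtractf fns.scale_right_diff_distrib)
  also have "\<dots> = fns_scale (1/2 * (?S (- n - 2 - k) - ?S (k - 1) + ?S (- k - 1) - ?S (n + k)))
      (fns_psi (n + k) v)"
    by (simp add: L_term_commute sum_subtractf sum.distrib flip: fns.scale_sum_left)
  also have "1/2 * (?S (- n - 2 - k) - ?S (k - 1) + ?S (- k - 1) - ?S (n + k))
      = - (of_int k + 1/2 + of_int n / 2 :: complex)"
  proof -
    have S: "?S z = (if z \<ge> 0 then of_int (z + 1) else 0)" if "z < int M" for z
      using sum_delta_int[OF that, of "\<lambda>z. of_int (z + 1)"] by simp
    \<comment> \<open>The four positions form two pairs of the shape z, - 2 - z, with weights z + 1
      and - (z + 1). At most one position of a pair is non-negative, and if neither is, then z = - 1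
      and the weight is 0. So each difference is given by one formula whatever the signs.\<close>
    have 1: "?S (- n - 2 - k) - ?S (n + k) = - of_int (n + k + 1)"
    proof (cases "n + k + 1 = 0")
      case True
      then show ?thesis using M(1) by (subst (1 2) S) auto
    next
      case False
      then show ?thesis using M(1) by (subst (1 2) S) auto
    qed
    have 2: "?S (- k - 1) - ?S (k - 1) = - of_int k"
      using M(1) by (subst (1 2) S) auto
    have "?S (- n - 2 - k) - ?S (k - 1) + ?S (- k - 1) - ?S (n + k)
        = (?S (- n - 2 - k) - ?S (n + k)) + (?S (- k - 1) - ?S (k - 1))"
      by (simp only: algebra_simps)
    also have "\<dots> = - of_int (n + k + 1) - of_int k"
      unfolding 1 2 by simp
    finally have sum: "?S (- n - 2 - k) - ?S (k - 1) + ?S (- k - 1) - ?S (n + k)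
        = - of_int (n + k + 1) - of_int k" .
    show ?thesis unfolding sum by (simp add: field_simps)
  qed
  finally show ?thesis by (simp add: algebra_simps fns.scale_left_diff_distrib)
qed

text \<open>The second product in each term starts with an annihilation operator on the vacuum; the
  first survives only while n + 1 + p < 0.\<close>

lemma fns_L_vacuum: "fns_L n fns_vacuum = fns_scale (1/2)
    (\<Sum>p<nat (- n - 1). fns_scale (of_nat (p + 1))
       (fns_psi (- 2 - int p) (fns_psi (n + 1 + int p) fns_vacuum)))"
proof -
  obtain M where M: "M \<ge> nat (- n - 1)"
    "fns_L n fns_vacuum = fns_scale (1/2) (\<Sum>p<M. L_term n p fns_vacuum)"
    by (rule fns_L_obtain)
  have "(\<Sum>p<M. L_term n p fns_vacuum) = (\<Sum>p<nat (- n - 1). L_term n p fns_vacuum)"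
    using M(1) by (intro sum.mono_neutral_right) (auto simp: L_term_def fns_psi_vacuum)
  then show ?thesis by (simp add: M(2) L_term_def fns_psi_vacuum)
qed

lemma fns_L_vacuum_zero: "n \<ge> - 1 \<Longrightarrow> fns_L n fns_vacuum = 0"
  by (simp add: fns_L_vacuum)

section \<open>Vacuum coefficients and the central term\<close>

abbreviation vev :: "fns \<Rightarrow> complex" where
  "vev u \<equiv> fns_inner u fns_vacuum"

lemma vev_psi: "n < 0 \<Longrightarrow> vev (fns_psi n u) = 0"
  by (simp add: fns_inner_psi fns_psi_vacuum)

lemma fns_L_sum: "fns_L n (\<Sum>i\<in>S. g i) = (\<Sum>i\<in>S. fns_L n (g i))"
proof (induction S rule: infinite_finite_induct)
  case (infinite A)
  then show ?case using fns_L_scale[of n 0 0] by simp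
next
  case empty
  then show ?case using fns_L_scale[of n 0 0] by simp
qed (auto simp: fns_L_add)

lemma vev_L: "vev (fns_L n fns_vacuum) = 0"
  by (simp add: fns_L_vacuum fns_inner_scale_left fns_inner_sum_left vev_psi)

lemma sum_central: "(\<Sum>p<m. of_nat (p + 1) * (of_nat p + 3/2 - of_nat (m + 1) / 2)) =
    (of_nat (m + 1) * ((of_nat (m + 1))\<^sup>2 - 1) / 12 :: complex)"
proof -
  \<comment> \<open>The summand also depends on the upper limit, so a free \<open>x\<close> replaces
    m + 1 before the induction. The right side sums p^2 + (5/2 - x/2) p + (3/2 - x/2) term by
    term.\<close>
  have *: "(\<Sum>p<m. of_nat (p + 1) * (of_nat p + 3/2 - x / 2)) =
    (of_nat m * (of_nat m - 1) * (2 * of_nat m - 1) / 6 + (5/2 - x / 2) * of_nat m * (of_nat m - 1) / 2 + (3/2 - x / 2) * of_nat m :: complex)" for x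
  proof (induction m)
    case (Suc m)
    show ?case unfolding sum.lessThan_Suc Suc.IH of_nat_Suc by (simp add: field_simps)
  qed simp
  show ?thesis unfolding * by (simp add: field_simps power2_eq_square)
qed

text \<open>Moving L_m past the first psi of each term of L_n Omega leaves one term that begins with
  a creation operator, of vacuum coefficient 0, and a pair of psi's that contracts to 1 exactly when
  m + n = 0.\<close>

lemma vev_L_L:
  "vev (fns_L m (fns_L n fns_vacuum))
    = (if m + n = 0 \<and> n < 0 then of_int (m * (m\<^sup>2 - 1)) / 24 else 0)"
proof -
  let ?N = "nat (- n - 1)"
  have summand: "vev (fns_L m (fns_psi (- 2 - int p) (fns_psi (n + 1 + int p) fns_vacuum)))
      = (if m + n = 0 then of_nat p + 3/2 - of_int m / 2 else 0)" if "p < ?N" for p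
  proof -
    have "vev (fns_psi (m + (- 2 - int p)) (fns_psi (n + 1 + int p) fns_vacuum))
        = (if m + n = 0 then 1 else 0)"
      using that by (auto simp: fns_psi_swap[of "m + (- 2 - int p)"] fns_inner_diff_left vev_psi
          fns_inner_vacuum)
    then show ?thesis
      by (simp add: fns_L_psi[of m "- 2 - int p"] fns_inner_diff_left vev_psi fns_inner_scale_left
          field_simps)
  qed
  have "vev (fns_L m (fns_L n fns_vacuum))
    = 1/2 * (\<Sum>p<?N. of_nat (p + 1) * (if m + n = 0 then of_nat p + 3/2 - of_int m / 2 else 0))"
    by (simp add: fns_L_vacuum[of n] fns_L_scale fns_L_sum fns_inner_scale_left fns_inner_sum_left summand)
  also have "\<dots> = (if m + n = 0 \<and> n < 0 then of_int (m * (m\<^sup>2 - 1)) / 24 else 0)"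
  proof (cases "m + n = 0 \<and> n < 0")
    case True
    then have "m = int (?N + 1)" by auto
    then have m: "of_int m = (of_nat (?N + 1) :: complex)"
      by (metis of_int_of_nat_eq)
    have "(\<Sum>p<?N. of_nat (p + 1) * (of_nat p + 3/2 - of_int m / 2))
        = (of_int m * ((of_int m)\<^sup>2 - 1) / 12 :: complex)"
      unfolding m by (rule sum_central)
    with True show ?thesis by (simp add: mult.commute)
  next
    case False
    then show ?thesis by (cases "n < 0") auto
  qed
  finally show ?thesis .
qed

lemma fns_L_zero [simp]: "fns_L n 0 = 0"
  using fns_L_scale[of n 0 0] by simp

lemma fns_L_minus: "fns_L n (- u) = - fns_L n u"
  using fns_L_scale[of n "- 1" u] by simp

lemma fns_L_diff: "fns_L n (u - v) = fns_L n u - fns_L n v"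
  using fns_L_add[of n u "- v"] by (simp add: fns_L_minus)

text \<open>The mixed terms are symmetric in \<open>m\<close> and \<open>n\<close> and cancel. The
  remaining coefficient is m - n times the one in [L_(m+n), psi(k)], so the commutator minus (m - n)
  L_(m+n) commutes with every psi.\<close>

lemma fns_L_commutator_psi:
  "fns_L m (fns_L n (fns_psi k v)) - fns_L n (fns_L m (fns_psi k v))
    = fns_psi k (fns_L m (fns_L n v) - fns_L n (fns_L m v))
      - fns_scale (of_int (m - n) * (of_int k + 1/2 + of_int (m + n) / 2)) (fns_psi (m + n + k) v)"
proof -
  define c :: "int \<Rightarrow> int \<Rightarrow> complex" where "c n k = of_int k + 1/2 + of_int n / 2" for n k
  have L_psi: "fns_L n (fns_psi k v) = fns_psi k (fns_L n v) - fns_scale (c n k) (fns_psi (n + k) v)"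
    for n k v
    by (simp only: c_def fns_L_psi)
  have LL: "fns_L m (fns_L n (fns_psi k v)) = fns_psi k (fns_L m (fns_L n v))
      - fns_scale (c m k) (fns_psi (m + k) (fns_L n v)) - fns_scale (c n k) (fns_psi (n + k) (fns_L m v))
      + fns_scale (c n k * c m (n + k)) (fns_psi (m + n + k) v)" for m n
    by (simp add: L_psi fns_L_diff fns_L_scale fns.scale_right_diff_distrib add.assoc)
  have "fns_L m (fns_L n (fns_psi k v)) - fns_L n (fns_L m (fns_psi k v))
      = fns_psi k (fns_L m (fns_L n v) - fns_L n (fns_L m v))
        + (fns_scale (c n k * c m (n + k)) (fns_psi (m + n + k) v)
          - fns_scale (c m k * c n (m + k)) (fns_psi (m + n + k) v))"
    unfolding LL[of m n] LL[of n m] by (simp add: add.commute[of n m])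
  also have "fns_scale (c n k * c m (n + k)) (fns_psi (m + n + k) v)
          - fns_scale (c m k * c n (m + k)) (fns_psi (m + n + k) v)
      = - fns_scale (of_int (m - n) * c (m + n) k) (fns_psi (m + n + k) v)"
    unfolding fns.scale_left_diff_distrib[symmetric] fns.scale_minus_left[symmetric]
    by (rule arg_cong[of _ _ "\<lambda>c. fns_scale c _"]) (simp add: c_def field_simps)
  finally show ?thesis by (simp add: c_def)
qed

lemma fns_L_commutator:
  "fns_L m (fns_L n v) - fns_L n (fns_L m v)
    = fns_scale (of_int (m - n)) (fns_L (m + n) v)
      + (if m + n = 0 then fns_scale (of_int (m * (m\<^sup>2 - 1)) / 24) v else 0)"
proof -
  \<comment> \<open>The defect \<open>T\<close> commutes with every \<open>\<psi>\<close>, so it vanishes as soon as it kills the vacuum; and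
    \<open>T \<Omega>\<close> is annihilated by all \<open>\<psi>(n)\<close> with \<open>n \<ge> 0\<close>, so only its vacuum coefficient matters.\<close>
  define c where "c = (if m + n = 0 then of_int (m * (m\<^sup>2 - 1)) / 24 else 0 :: complex)"
  define T where "T v = fns_L m (fns_L n v) - fns_L n (fns_L m v)
      - fns_scale (of_int (m - n)) (fns_L (m + n) v) - fns_scale c v" for v
  have T_psi: "T (fns_psi k v) = fns_psi k (T v)" for k v
    unfolding T_def fns_L_commutator_psi fns_L_psi[of "m + n"]
    by (simp add: fns.scale_right_diff_distrib del: of_int_add of_int_diff)
  have T_add: "T (u + v) = T u + T v" for u v
    by (simp add: T_def fns_L_add fns.scale_right_distrib algebra_simps)
  have T_scale: "T (fns_scale k v) = fns_scale k (T v)" for k v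
    by (simp add: T_def fns_L_scale fns.scale_right_diff_distrib mult.commute)
  have "vev (T fns_vacuum) = vev (fns_L m (fns_L n fns_vacuum)) - vev (fns_L n (fns_L m fns_vacuum)) - c"
    by (simp only: T_def fns_inner_diff_left fns_inner_scale_left vev_L fns_inner_vacuum) simp
  also have "\<dots> = 0"
  proof (cases "m + n = 0")
    case True
    then have n: "n = - m" by simp
    show ?thesis unfolding vev_L_L c_def n
      \<comment> \<open>Only the product whose right factor has negative index contributes: the
        first one if m > 0, the second if m < 0. They agree because m(m^2 - 1) is odd.\<close>
      by (cases m "0 :: int" rule: linorder_cases) (simp_all add: field_simps)
  next
    case False
    then show ?thesis by (simp add: vev_L_L c_def add.commute)
  qed
  finally have "vev (T fns_vacuum) = 0" .
  moreover have "fns_psi k (T fns_vacuum) = 0" if "k \<ge> 0" for k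
    using that T_psi[of k fns_vacuum] T_scale[of 0 0] by (simp add: fns_psi_vacuum)
  ultimately have vac: "T fns_vacuum = 0"
    using fns_annihilated[of "T fns_vacuum"] by simp
  have "T v = 0"
    by (induction v rule: fns_induct) (simp_all add: vac T_add T_scale T_psi)
  then show ?thesis by (simp add: T_def c_def algebra_simps)
qed

text \<open>The coefficient k + 1/2 + n/2 changes sign under k to - 1 - k and n to - n, which makes
  the commutation rule with psi compatible with adjoints. Induction on \<open>u\<close> reduces to
  the vacuum, where induction on \<open>v\<close> takes over.\<close>

lemma fns_L_adjoint: "fns_inner (fns_L n u) v = fns_inner u (fns_L (- n) v)"
proof (induction u arbitrary: v rule: fns_induct)
  case vacuum
  show ?case
  proof (induction v rule: fns_induct)
    case vacuum
    then show ?case using vev_L[of "- n"] fns_inner_cnj[of "fns_L (- n) fns_vacuum" fns_vacuum]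
      by (simp add: vev_L)
  next
    case (psi k v)
    have "fns_inner (fns_L n fns_vacuum) (fns_psi k v)
        = fns_inner (fns_psi (- 1 - k) (fns_L n fns_vacuum)) v"
      by (simp add: fns_inner_psi)
    also have "fns_psi (- 1 - k) (fns_L n fns_vacuum)
        = fns_scale (of_int (- 1 - k) + 1/2 + of_int n / 2) (fns_psi (n + (- 1 - k)) fns_vacuum)"
      using psi(2) fns_L_psi[of n "- 1 - k" fns_vacuum] by (simp add: fns_psi_vacuum)
    also have "fns_inner \<dots> v
        = (of_int (- 1 - k) + 1/2 + of_int n / 2) * fns_inner fns_vacuum (fns_psi (- n + k) v)"
      by (simp add: fns_inner_scale_left fns_inner_psi)
    also have "\<dots> = fns_inner fns_vacuum (fns_L (- n) (fns_psi k v))"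
    proof -
      have "fns_inner fns_vacuum (fns_psi k w) = 0" for w
        using psi(2) by (metis fns_inner_cnj complex_cnj_zero vev_psi)
      then show ?thesis
        by (simp only: fns_L_psi fns_inner_diff_right fns_inner_scale_right) (simp add: field_simps)
    qed
    finally show ?case .
  qed (simp_all add: fns_inner_add_right fns_inner_scale_right fns_L_add fns_L_scale)
next
  case (psi k u)
  have "fns_inner (fns_L n (fns_psi k u)) v = fns_inner u (fns_L (- n) (fns_psi (- 1 - k) v))
      - (of_int k + 1/2 + of_int n / 2) * fns_inner u (fns_psi (- 1 - (n + k)) v)"
    by (simp add: fns_L_psi[of n] fns_inner_diff_left fns_inner_scale_left fns_inner_psi psi(1))
  also have "\<dots> = fns_inner u (fns_psi (- 1 - k) (fns_L (- n) v))"
  proof -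
    have "- n + (- 1 - k) = - 1 - (n + k)" by simp
    then show ?thesis
      by (simp only: fns_L_psi fns_inner_diff_right fns_inner_scale_right) (simp add: field_simps)
  qed
  finally show ?case by (simp add: fns_inner_psi)
qed (simp_all add: fns_inner_add_left fns_inner_scale_left fns_L_add fns_L_scale)

section \<open>The representation of the Virasoro algebra\<close>

lemma lookup_vir_scale: "Poly_Mapping.lookup (vir_scale k x) a = k * Poly_Mapping.lookup x a"
  by (simp add: vir_scale_def map.rep_eq when_def)

lemma vector_space_vir: "vector_space vir_scale"
  by standard (auto intro!: poly_mapping_eqI simp: lookup_vir_scale lookup_add algebra_simps)

lemma vir_embed_superset:
  assumes "finite S" "Poly_Mapping.keys x \<subseteq> S"
  shows "vir_embed x = (\<Sum>a\<in>S. scalar (Poly_Mapping.lookup x a) * gen a)"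
  unfolding vir_embed_def using assms
  by (intro sum.mono_neutral_left) (auto simp: in_keys_iff)

lemma vir_embed_add: "vir_embed (x + y) = vir_embed x + vir_embed y"
proof -
  let ?S = "Poly_Mapping.keys x \<union> Poly_Mapping.keys y"
  have "Poly_Mapping.keys (x + y) \<subseteq> ?S" by (rule Poly_Mapping.keys_add)
  then show ?thesis
    by (simp add: vir_embed_superset[of ?S] lookup_add scalar_add distrib_right sum.distrib)
qed

lemma vir_embed_zero [simp]: "vir_embed 0 = 0"
  by (simp add: vir_embed_def)

lemma vir_embed_scale: "vir_embed (vir_scale k x) = scalar k * vir_embed x"
proof -
  have "Poly_Mapping.keys (vir_scale k x) \<subseteq> Poly_Mapping.keys x"
    by (auto simp: in_keys_iff lookup_vir_scale)
  then show ?thesis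
    by (simp add: vir_embed_superset[of "Poly_Mapping.keys x"] lookup_vir_scale scalar_mult
        sum_distrib_left mult.assoc)
qed

lemma vir_embed_single: "vir_embed (Poly_Mapping.single a k) = scalar k * gen a"
  by (cases "k = 0") (simp_all add: vir_embed_def)

fun fns_vir_gen :: "vir_basis \<Rightarrow> fns \<Rightarrow> fns" where
  "fns_vir_gen (VL n) = fns_L n"
| "fns_vir_gen VC = fns_scale (1/2)"

interpretation vir: word_action fns_scale fns_vir_gen
proof unfold_locales
  fix g k and u v :: fns
  show "fns_vir_gen g (u + v) = fns_vir_gen g u + fns_vir_gen g v"
    by (cases g) (simp_all add: fns_L_add fns.scale_right_distrib)
  show "fns_vir_gen g (fns_scale k v) = fns_scale k (fns_vir_gen g v)"
    by (cases g) (simp_all add: fns_L_scale)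
qed

text \<open>Routing the action through the free algebra makes evaluation at the vacuum intertwine it
  with the Verma module almost by definition.\<close>

definition fns_rep :: "vir \<Rightarrow> fns \<Rightarrow> fns" where
  "fns_rep x = vir.act (vir_embed x)"

lemma fns_rep_eq:
  "fns_rep x v = (\<Sum>a\<in>Poly_Mapping.keys x. fns_scale (Poly_Mapping.lookup x a) (fns_vir_gen a v))"
proof -
  have "vir.act (\<Sum>a\<in>S. scalar (Poly_Mapping.lookup x a) * gen a) v
    = (\<Sum>a\<in>S. fns_scale (Poly_Mapping.lookup x a) (fns_vir_gen a v))" for S
    by (induction S rule: infinite_finite_induct) (auto simp: vir.act_add_left vir.act_mult)
  then show ?thesis by (simp add: fns_rep_def vir_embed_def)
qed

lemma fns_rep_scale: "fns_rep (vir_scale k x) v = fns_scale k (fns_rep x v)"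
  by (simp add: fns_rep_def vir_embed_scale vir.act_mult)

lemma fns_rep_sum: "fns_rep (\<Sum>i\<in>S. g i) v = (\<Sum>i\<in>S. fns_rep (g i) v)"
  by (induction S rule: infinite_finite_induct) (auto simp: fns_rep_def vir_embed_add vir.act_add_left)

lemma fns_rep_basis_bracket:
  "fns_rep (vir_basis_bracket a b) v
    = fns_vir_gen a (fns_vir_gen b v) - fns_vir_gen b (fns_vir_gen a v)"
  by (cases a; cases b)
    (simp_all add: fns_rep_def vir_embed_add vir_embed_single vir.act_add_left vir.act_mult
      fns_L_commutator fns_L_scale)

lemma fns_vir_gen_sum: "fns_vir_gen a (\<Sum>i\<in>S. g i) = (\<Sum>i\<in>S. fns_vir_gen a (g i))"
  using vir.T_scale[of a 0 0]
  by (induction S rule: infinite_finite_induct) (auto simp: vir.T_add)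

lemma fns_rep_bracket: "fns_rep (vir_bracket x y) v = fns_rep x (fns_rep y v) - fns_rep y (fns_rep x v)"
proof -
  let ?k = "\<lambda>a b. Poly_Mapping.lookup x a * Poly_Mapping.lookup y b"
  have comp: "fns_rep x (fns_rep y v) = (\<Sum>a\<in>Poly_Mapping.keys x. \<Sum>b\<in>Poly_Mapping.keys y.
      fns_scale (Poly_Mapping.lookup x a * Poly_Mapping.lookup y b) (fns_vir_gen a (fns_vir_gen b v)))" for x y
    by (simp add: fns_rep_eq fns_vir_gen_sum vir.T_scale fns.scale_sum_right)
  have "fns_rep y (fns_rep x v) = (\<Sum>a\<in>Poly_Mapping.keys x. \<Sum>b\<in>Poly_Mapping.keys y.
      fns_scale (?k a b) (fns_vir_gen b (fns_vir_gen a v)))"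
    unfolding comp by (subst sum.swap) (simp add: mult.commute)
  then show ?thesis
    by (simp add: comp[of x y] vir_bracket_def fns_rep_sum fns_rep_scale fns_rep_basis_bracket
        fns.scale_right_diff_distrib sum_subtractf)
qed

lemma vir_representation_fns: "vir_representation fns_scale fns_rep"
  unfolding vir_representation_def Vector_Spaces.linear_iff
  by (auto simp: vector_space_fns vector_space_vir fns_rep_bracket fns_rep_scale)
    (auto simp: fns_rep_def vir.act_add_right vir.act_scale_right vir_embed_add vir.act_add_left)

lemma fns_rep_single: "fns_rep (Poly_Mapping.single (VL n) 1) = fns_L n"
  by (rule ext) (simp add: fns_rep_def vir_embed_single vir.act_mult)

section \<open>Verma modules\<close>

lemma left_ideal_verma: "left_ideal (verma_ideal c h)"
  unfolding verma_ideal_def by (rule left_ideal_cyclic_ideal)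

text \<open>Computations in the Verma module are done on representatives. The ideal is a left ideal,
  so congruences may be multiplied from the left only.\<close>

definition verma_eq :: "complex \<Rightarrow> complex \<Rightarrow> vir_basis free_algebra \<Rightarrow> vir_basis free_algebra \<Rightarrow> bool" where
  "verma_eq c h x y \<longleftrightarrow> x - y \<in> verma_ideal c h"

lemma verma_eq_refl [simp]: "verma_eq c h x x"
  using left_ideal_verma by (simp add: verma_eq_def left_ideal_def)

lemma verma_eq_sym: "verma_eq c h x y \<Longrightarrow> verma_eq c h y x"
  using left_ideal_diff[OF left_ideal_verma, of 0 c h "x - y"] left_ideal_verma[of c h]
  by (simp add: verma_eq_def left_ideal_def)

lemma verma_eq_add: "verma_eq c h x x' \<Longrightarrow> verma_eq c h y y' \<Longrightarrow> verma_eq c h (x + y) (x' + y')"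
  using left_ideal_verma[of c h] by (simp add: verma_eq_def left_ideal_def add_diff_add)

lemma verma_eq_mult: "verma_eq c h x y \<Longrightarrow> verma_eq c h (a * x) (a * y)"
  using left_ideal_verma[of c h]
  by (simp add: verma_eq_def left_ideal_def flip: right_diff_distrib)

lemma verma_eq_trans [trans]: "verma_eq c h x y \<Longrightarrow> verma_eq c h y z \<Longrightarrow> verma_eq c h x z"
  using verma_eq_add[of c h x y y z] by (simp add: verma_eq_def)

lemma mult_scalar_left: "x * (scalar k * y) = scalar k * (x * y)"
  by (metis mult.assoc scalar_commute)

lemma gen_scalar_mult: "gen g * (scalar k * y) = scalar k * (gen g * y)"
  by (rule mult_scalar_left)

lemma vir_scale_1 [simp]: "vir_scale 1 x = x"
  by (rule poly_mapping_eqI) (simp add: lookup_vir_scale)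

text \<open>The ideal contains each enveloping relation times any right factor, so generators can be
  exchanged in front of an arbitrary \<open>x\<close>.\<close>

lemma vir_relation:
  "verma_eq c h (gen a * (gen b * x)) (gen b * (gen a * x) + vir_embed (vir_basis_bracket a b) * x)"
proof -
  let ?a = "Poly_Mapping.single a 1" and ?b = "Poly_Mapping.single b 1"
  have "vir_embed ?a * vir_embed ?b - vir_embed ?b * vir_embed ?a - vir_embed (vir_bracket ?a ?b)
      \<in> vir_relations"
    unfolding vir_relations_def by blast
  then have "(vir_embed ?a * vir_embed ?b - vir_embed ?b * vir_embed ?a
      - vir_embed (vir_bracket ?a ?b)) * x \<in> verma_ideal c h"
    unfolding verma_ideal_def cyclic_ideal_def by (intro hull_inc) blast
  then show ?thesis
    by (simp add: vir_embed_single scalar_1 vir_bracket_def verma_eq_def left_diff_distrib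
        mult.assoc diff_diff_eq distrib_right)
qed

lemma verma_vacuum:
  "n > 0 \<Longrightarrow> verma_eq c h (gen (VL n)) 0" "verma_eq c h (gen (VL 0)) (scalar h)"
  "verma_eq c h (gen VC) (scalar c)"
proof -
  have "{gen (VL n) |n. n > 0} \<union> {gen (VL 0) - scalar h, gen VC - scalar c} \<subseteq> verma_ideal c h"
    unfolding verma_ideal_def cyclic_ideal_def by (rule order.trans[OF Un_upper2 hull_subset])
  then show "n > 0 \<Longrightarrow> verma_eq c h (gen (VL n)) 0" "verma_eq c h (gen (VL 0)) (scalar h)"
    "verma_eq c h (gen VC) (scalar c)"
    by (auto simp: verma_eq_def)
qed

lemma verma_central: "verma_eq c h (gen VC * x) (scalar c * x)"
proof (induction x rule: free_algebra_induct)
  case one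
  show ?case using verma_vacuum(3) by simp
next
  case (scalar k x)
  then have "verma_eq c h (scalar k * (gen VC * x)) (scalar k * (scalar c * x))"
    by (rule verma_eq_mult)
  then show ?case
    by (simp add: gen_scalar_mult mult_scalar_left[of "scalar k" c])
next
  case (gen g x)
  have "verma_eq c h (gen VC * (gen g * x)) (gen g * (gen VC * x))"
    using vir_relation[of c h VC g x] by simp
  also have "verma_eq c h \<dots> (gen g * (scalar c * x))"
    by (rule verma_eq_mult[OF gen])
  finally show ?case by (simp add: gen_scalar_mult)
next
  case (add x y)
  then show ?case by (simp add: distrib_left verma_eq_add)
qed

lemma verma_commute:
  "verma_eq c h (gen (VL m) * (gen (VL n) * x))
    (gen (VL n) * (gen (VL m) * x) + scalar (of_int (m - n)) * (gen (VL (m + n)) * x)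
      + scalar (if m + n = 0 then c * of_int (m * (m\<^sup>2 - 1)) / 12 else 0) * x)"
proof -
  define k :: complex where "k = of_int (m * (m\<^sup>2 - 1)) / 12"
  have bracket: "vir_embed (vir_basis_bracket (VL m) (VL n))
      = scalar (of_int (m - n)) * gen (VL (m + n)) + scalar (if m + n = 0 then k else 0) * gen VC"
    by (simp add: k_def vir_embed_add vir_embed_single)
  have "verma_eq c h (scalar (if m + n = 0 then k else 0) * (gen VC * x))
      (scalar (if m + n = 0 then k else 0) * (scalar c * x))"
    by (rule verma_eq_mult[OF verma_central])
  also have "scalar (if m + n = 0 then k else 0) * (scalar c * x)
      = scalar (if m + n = 0 then k * c else 0) * x"
    by (simp add: scalar_mult mult.assoc)
  finally have "verma_eq c h (vir_embed (vir_basis_bracket (VL m) (VL n)) * x)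
    (scalar (of_int (m - n)) * (gen (VL (m + n)) * x) + scalar (if m + n = 0 then k * c else 0) * x)"
    unfolding bracket distrib_right mult.assoc by (rule verma_eq_add[OF verma_eq_refl])
  then have "verma_eq c h (gen (VL n) * (gen (VL m) * x) + vir_embed (vir_basis_bracket (VL m) (VL n)) * x)
    (gen (VL n) * (gen (VL m) * x)
      + (scalar (of_int (m - n)) * (gen (VL (m + n)) * x) + scalar (if m + n = 0 then k * c else 0) * x))"
    by (intro verma_eq_add) simp_all
  with vir_relation have "verma_eq c h (gen (VL m) * (gen (VL n) * x)) (gen (VL n) * (gen (VL m) * x)
      + (scalar (of_int (m - n)) * (gen (VL (m + n)) * x) + scalar (if m + n = 0 then k * c else 0) * x))"
    by (rule verma_eq_trans)
  then show ?thesis by (simp only: add.assoc k_def mult.commute[of c] times_divide_eq_left)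
qed

section \<open>Spanning words and weights of the Verma module\<close>

definition verma_word :: "nat list \<Rightarrow> vir_basis free_algebra" where
  "verma_word ks = foldr (\<lambda>k x. gen (VL (- 1 - int k)) * x) ks 1"

lemma verma_word_simps [simp]:
  "verma_word [] = 1" "verma_word (k # ks) = gen (VL (- 1 - int k)) * verma_word ks"
  by (simp_all add: verma_word_def)

inductive_set verma_span :: "complex \<Rightarrow> complex \<Rightarrow> vir_basis free_algebra set" for c h where
  zero: "verma_eq c h x 0 \<Longrightarrow> x \<in> verma_span c h"
| word: "verma_word ks \<in> verma_span c h"
| scale: "x \<in> verma_span c h \<Longrightarrow> scalar k * x \<in> verma_span c h"
| add: "x \<in> verma_span c h \<Longrightarrow> y \<in> verma_span c h \<Longrightarrow> x + y \<in> verma_span c h"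

lemma verma_span_cong:
  assumes "verma_eq c h x y" "y \<in> verma_span c h"
  shows "x \<in> verma_span c h"
proof -
  have "verma_eq c h (x - y) 0" using assms(1) by (simp add: verma_eq_def)
  from verma_span.add[OF verma_span.zero[OF this] assms(2)] show ?thesis by simp
qed

lemma verma_span_creation:
  assumes "x \<in> verma_span c h" "n < 0"
  shows "gen (VL n) * x \<in> verma_span c h"
  using assms(1)
proof induction
  case (zero x)
  then show ?case using verma_eq_mult[of c h x 0] by (auto intro: verma_span.zero)
next
  case (word ks)
  have "n = - 1 - int (nat (- 1 - n))" using assms(2) by simp
  then show ?case by (metis verma_span.word verma_word_simps(2))
qed (auto simp: gen_scalar_mult distrib_left intro: verma_span.intros)

text \<open>Commuting L_n through a factor L_(-1-k) produces L_(n-1-k), of either sign. Hence the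
  induction on the word treats all non-negative indices at once, and negative ones are creation
  operators.\<close>

lemma verma_span_annihilation:
  assumes "x \<in> verma_span c h" "n \<ge> 0"
  shows "gen (VL n) * x \<in> verma_span c h"
  using assms
proof (induction arbitrary: n)
  case (zero x)
  then show ?case using verma_eq_mult[of c h x 0] by (auto intro: verma_span.zero)
next
  case (word ks)
  then show ?case
  proof (induction ks arbitrary: n)
    case Nil
    show ?case
    proof (cases "n = 0")
      case True
      have "scalar h * verma_word [] \<in> verma_span c h"
        by (intro verma_span.scale verma_span.word)
      then show ?thesis
        using True verma_span_cong[OF verma_vacuum(2)] by simp
    next
      case False
      with Nil show ?thesis using verma_vacuum(1)[of n c h] by (auto intro: verma_span.zero)
    qed
  next
    case (Cons k ks)
    have "gen (VL (n + (- 1 - int k))) * verma_word ks \<in> verma_span c h"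
      using Cons.IH[of "n + (- 1 - int k)"] verma_span_creation[OF verma_span.word, of "n + (- 1 - int k)"]
      by (cases "n + (- 1 - int k) \<ge> 0") auto
    moreover have "gen (VL (- 1 - int k)) * (gen (VL n) * verma_word ks) \<in> verma_span c h"
      by (rule verma_span_creation[OF Cons.IH[OF Cons.prems]]) simp
    ultimately show ?case
      unfolding verma_word_simps
      by - (rule verma_span_cong[OF verma_commute],
        intro verma_span.add verma_span.scale verma_span.word)
  qed
qed (auto simp: gen_scalar_mult distrib_left intro: verma_span.intros)

lemma verma_span_UNIV: "x \<in> verma_span c h"
proof (induction x rule: free_algebra_induct)
  case one
  show ?case using verma_span.word[of "[]"] by simp
next
  case (gen g x)
  show ?case
  proof (cases g)
    case (VL n)
    then show ?thesis
      using gen verma_span_creation[of x c h n] verma_span_annihilation[of x c h n]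
      by (cases "n < 0") auto
  next
    case VC
    then show ?thesis using verma_span_cong[OF verma_central verma_span.scale[OF gen]] by simp
  qed
qed (auto intro: verma_span.intros)

lemma verma_word_weight:
  "verma_eq c h (gen (VL 0) * verma_word ks)
    (scalar (h + of_nat (sum_list (map Suc ks))) * verma_word ks)"
proof (induction ks)
  case Nil
  show ?case using verma_vacuum(2) by simp
next
  case (Cons k ks)
  let ?g = "gen (VL (- 1 - int k))" and ?d = "h + of_nat (sum_list (map Suc ks))"
  have "verma_eq c h (gen (VL 0) * (?g * verma_word ks))
    (?g * (gen (VL 0) * verma_word ks) + scalar (of_nat k + 1) * (?g * verma_word ks))"
    using verma_commute[of c h 0 "- 1 - int k" "verma_word ks"] by simp
  also have "verma_eq c h \<dots> (?g * (scalar ?d * verma_word ks) + scalar (of_nat k + 1) * (?g * verma_word ks))"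
    by (intro verma_eq_add verma_eq_mult Cons.IH verma_eq_refl)
  finally show ?case
    by (simp add: gen_scalar_mult scalar_add distrib_right algebra_simps)
qed

text \<open>On a vector of weight \<open>h + d\<close> this acts as \<open>(d - 1) \<cdots> (d - e)\<close>: it removes the weights
  \<open>h + 1, \<dots>, h + e\<close> and keeps the highest weight vector up to a non-zero factor.\<close>

fun weight_filter :: "complex \<Rightarrow> nat \<Rightarrow> vir_basis free_algebra" where
  "weight_filter h 0 = 1"
| "weight_filter h (Suc e) = weight_filter h e * (gen (VL 0) - scalar (h + of_nat (Suc e)))"

lemma weight_filter_eigenvector:
  assumes "verma_eq c h (gen (VL 0) * w) (scalar (h + of_nat d) * w)"
  shows "verma_eq c h (weight_filter h e * w) (scalar (\<Prod>i<e. of_nat d - of_nat (Suc i)) * w)"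
proof (induction e)
  case 0
  show ?case by (simp add: scalar_1)
next
  case (Suc e)
  have "verma_eq c h ((gen (VL 0) - scalar (h + of_nat (Suc e))) * w)
     (scalar (h + of_nat d) * w + - (scalar (h + of_nat (Suc e)) * w))"
    using verma_eq_add[OF assms verma_eq_refl, of "- (scalar (h + of_nat (Suc e)) * w)"]
    by (simp add: left_diff_distrib)
  also have "scalar (h + of_nat d) * w + - (scalar (h + of_nat (Suc e)) * w)
     = scalar (of_nat d - of_nat (Suc e)) * w"
    by (simp add: scalar_diff[symmetric] left_diff_distrib[symmetric] del: of_nat_Suc)
  finally have "verma_eq c h (weight_filter h (Suc e) * w)
      (weight_filter h e * (scalar (of_nat d - of_nat (Suc e)) * w))"
    by (simp add: mult.assoc verma_eq_mult del: of_nat_Suc)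
  also have "\<dots> = scalar (of_nat d - of_nat (Suc e)) * (weight_filter h e * w)"
    by (rule mult_scalar_left)
  also have "verma_eq c h \<dots> (scalar (of_nat d - of_nat (Suc e)) *
      (scalar (\<Prod>i<e. of_nat d - of_nat (Suc i)) * w))"
    by (rule verma_eq_mult[OF Suc])
  finally show ?case by (simp add: scalar_mult mult.assoc[symmetric] mult.commute del: of_nat_Suc)
qed

lemma weight_filter_scalar: "\<exists>e k. verma_eq c h (weight_filter h e * x) (scalar k)"
proof -
  \<comment> \<open>Asking for all large \<open>e\<close> lets the two summands in the additive case
    share one filter.\<close>
  have "\<exists>d. \<forall>e\<ge>d. \<exists>k. verma_eq c h (weight_filter h e * x) (scalar k)"
    using verma_span_UNIV[of x c h]
  proof induction
    case (zero x)
    then have "verma_eq c h (weight_filter h e * x) (scalar 0)" for e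
      using verma_eq_mult[of c h x 0 "weight_filter h e"] by simp
    then show ?case by blast
  next
    case (word ks)
    let ?d = "sum_list (map Suc ks)"
    have filter: "verma_eq c h (weight_filter h e * verma_word ks)
        (scalar (\<Prod>i<e. of_nat ?d - of_nat (Suc i)) * verma_word ks)" for e
      by (rule weight_filter_eigenvector[OF verma_word_weight])
    have "\<exists>k. verma_eq c h (weight_filter h e * verma_word ks) (scalar k)" if "e \<ge> ?d" for e
    proof (cases ks)
      case Nil
      then show ?thesis using filter[of e] by auto
    next
      case (Cons k ks')
      then obtain j where j: "?d = Suc j" by (cases ?d) auto
      \<comment> \<open>A non-empty word has weight d > 0 above h, and the factor i = d - 1 vanishes
        once e \<ge> d.\<close>
      have "(\<Prod>i<e. of_nat ?d - of_nat (Suc i) :: complex) = 0"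
        unfolding j using that j by (intro prod_zero) auto
      with filter[of e] have "verma_eq c h (weight_filter h e * verma_word ks) (scalar 0)"
        by (simp only: scalar_0 mult_zero_left)
      then show ?thesis by blast
    qed
    then show ?case by blast
  next
    case (scale x l)
    then show ?case
      by (metis mult_scalar_left scalar_mult verma_eq_mult)
  next
    case (add x y)
    then obtain d d' where "\<forall>e\<ge>d. \<exists>k. verma_eq c h (weight_filter h e * x) (scalar k)"
      "\<forall>e\<ge>d'. \<exists>k. verma_eq c h (weight_filter h e * y) (scalar k)"
      by blast
    then show ?case
      by (intro exI[of _ "max d d'"]) (metis distrib_left max.bounded_iff scalar_add verma_eq_add)
  qed
  then show ?thesis by blast
qed

section \<open>The Verma module as a module of classes\<close>

definition verma_class :: "complex \<Rightarrow> complex \<Rightarrow> vir_basis free_algebra \<Rightarrow> vir_basis free_algebra set" where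
  "verma_class c h x = {y. verma_eq c h y x}"

lemma verma_class_eq_iff: "verma_class c h x = verma_class c h y \<longleftrightarrow> verma_eq c h x y"
  unfolding verma_class_def by (auto intro: verma_eq_trans verma_eq_sym)

lemma verma_coset:
  assumes "vm_add M = (+)"
  shows "coset M (verma_ideal c h) x = verma_class c h x"
proof -
  have "y \<in> (+) x ` verma_ideal c h" if "y - x \<in> verma_ideal c h" for y
    using that by (intro image_eqI[of _ _ "y - x"]) simp_all
  then show ?thesis unfolding coset_def verma_class_def verma_eq_def assms by auto
qed

text \<open>Operations on a quotient are unions over all representatives; compatibility with the
  congruence makes all members of the union equal.\<close>

lemma UN_verma_class:
  assumes "\<And>y. verma_eq c h y x \<Longrightarrow> verma_eq c h (F y) (F x)"
  shows "(\<Union>y\<in>verma_class c h x. verma_class c h (F y)) = verma_class c h (F x)"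
proof -
  have "verma_class c h (F y) = verma_class c h (F x)" if "y \<in> verma_class c h x" for y
    using that assms by (simp add: verma_class_eq_iff) (simp add: verma_class_def)
  moreover have "x \<in> verma_class c h x" by (simp add: verma_class_def)
  ultimately show ?thesis by blast
qed

lemma verma_module_simps:
  "vm_carrier (verma_module c h) = range (verma_class c h)"
  "vm_add (verma_module c h) (verma_class c h x) (verma_class c h y) = verma_class c h (x + y)"
  "vm_scale (verma_module c h) k (verma_class c h x) = verma_class c h (scalar k * x)"
  "vm_act (verma_module c h) g (verma_class c h x) = verma_class c h (vir_embed g * x)"
  by (simp_all add: verma_module_def quotient_module_def verma_coset UN_verma_class verma_eq_add
      verma_eq_mult)

lemma verma_submodule_mult:
  assumes N: "vir_submodule (verma_module c h) N" and "verma_class c h x \<in> N"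
  shows "verma_class c h (a * x) \<in> N"
proof (induction a rule: free_algebra_induct)
  case one
  show ?case using assms(2) by simp
next
  case (scalar k a)
  then show ?case using N by (simp add: vir_submodule_def mult.assoc) (metis verma_module_simps(3))
next
  case (gen g a)
  have "vm_act (verma_module c h) (Poly_Mapping.single g 1) (verma_class c h (a * x)) \<in> N"
    using gen N by (simp add: vir_submodule_def)
  then show ?case
    by (simp add: verma_module_simps vir_embed_single scalar_1 mult.assoc)
next
  case (add a b)
  then show ?case using N
    by (simp add: vir_submodule_def distrib_right) (metis verma_module_simps(2))
qed

section \<open>The submodule generated by the vacuum\<close>

abbreviation evaluate :: "vir_basis free_algebra \<Rightarrow> fns" where
  "evaluate a \<equiv> vir.act a fns_vacuum"

abbreviation verma_half :: "vir_basis free_algebra set vir_module" where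
  "verma_half \<equiv> verma_module (1/2) 0"

text \<open>The Virasoro relations hold on all of \<open>fns\<close> with C acting as 1/2, and the
  vacuum is a highest weight vector of weight 0, so evaluation descends to the Verma module.\<close>

lemma evaluate_verma_ideal:
  assumes "x \<in> verma_ideal (1/2) 0"
  shows "evaluate x = 0"
proof (rule vir.cyclic_ideal_annihilates)
  show "x \<in> cyclic_ideal vir_relations
     ({gen (VL n) |n. n > 0} \<union> {gen (VL 0) - scalar 0, gen VC - scalar (1/2)})"
    using assms by (simp add: verma_ideal_def)
  show "vir.act r u = 0" if "r \<in> vir_relations" for r u
  proof -
    obtain y z where r: "r = vir_embed y * vir_embed z - vir_embed z * vir_embed y
        - vir_embed (vir_bracket y z)"
      using \<open>r \<in> vir_relations\<close> unfolding vir_relations_def by blast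
    show ?thesis
      using fns_rep_bracket[of y z u] by (simp add: r fns_rep_def vir.act_diff_left vir.act_mult)
  qed
  show "evaluate s = 0"
    if "s \<in> {gen (VL n) |n. n > 0} \<union> {gen (VL 0) - scalar 0, gen VC - scalar (1/2)}" for s
    using that by (auto simp: vir.act_diff_left fns_L_vacuum_zero)
qed

lemma evaluate_cong: "verma_eq (1/2) 0 x y \<Longrightarrow> evaluate x = evaluate y"
  using evaluate_verma_ideal[of "x - y"] by (simp add: verma_eq_def vir.act_diff_left)

text \<open>The adjoint reverses words, conjugates coefficients and sends L_n to L_(-n); C is
  self-adjoint because it acts by the real number 1/2. Existence is enough, so no star operation is
  set up on the free algebra.\<close>

lemma vir_act_adjoint: "\<exists>b. \<forall>u v. fns_inner (vir.act a u) v = fns_inner u (vir.act b v)"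
proof (induction a rule: free_algebra_induct)
  case one
  show ?case by (intro exI[of _ 1]) simp
next
  case (scalar k a)
  then obtain b where "\<forall>u v. fns_inner (vir.act a u) v = fns_inner u (vir.act b v)" by blast
  then show ?case
    by (intro exI[of _ "scalar (cnj k) * b"])
      (simp add: vir.act_mult fns_inner_scale_left fns_inner_scale_right)
next
  case (gen g a)
  then obtain b where b: "\<forall>u v. fns_inner (vir.act a u) v = fns_inner u (vir.act b v)" by blast
  show ?case
  proof (cases g)
    case (VL n)
    with b show ?thesis
      by (intro exI[of _ "b * gen (VL (- n))"]) (simp add: vir.act_mult fns_L_adjoint)
  next
    case VC
    with b show ?thesis
      by (intro exI[of _ "b * gen VC"])
        (simp add: vir.act_mult fns_inner_scale_left fns_inner_scale_right vir.act_scale_right)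
  qed
next
  case (add a a')
  then obtain b b' where "\<forall>u v. fns_inner (vir.act a u) v = fns_inner u (vir.act b v)"
    "\<forall>u v. fns_inner (vir.act a' u) v = fns_inner u (vir.act b' v)" by blast
  then show ?case
    by (intro exI[of _ "b + b'"]) (simp add: vir.act_add_left fns_inner_add_left fns_inner_add_right)
qed

text \<open>L_0 is self-adjoint and kills the vacuum, so each factor of the filter acts on the
  vacuum coefficient as a scalar. None of these scalars is 0, so filtering cannot lose a non-zero
  coefficient.\<close>

lemma vev_weight_filter: "vev (vir.act (weight_filter 0 e) u) = (\<Prod>i<e. - of_nat (Suc i)) * vev u"
proof (induction e arbitrary: u)
  case (Suc e)
  have "vev (fns_L 0 u) = 0"
    using fns_L_adjoint[of 0 u fns_vacuum] by (simp add: fns_L_vacuum_zero)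
  then show ?case
    by (simp add: Suc vir.act_mult vir.act_diff_left fns_inner_diff_left fns_inner_scale_left
        del: of_nat_Suc)
qed simp

lemma proper_submodule_evaluate:
  assumes N: "vir_submodule verma_half N" and proper: "N \<noteq> vm_carrier verma_half"
    and x: "verma_class (1/2) 0 x \<in> N"
  shows "evaluate x = 0"
proof (rule ccontr)
  \<comment> \<open>By adjointness some \<open>b x\<close> has evaluation with non-zero vacuum coefficient; filtering its
    weights then puts a non-zero multiple of the highest weight vector into \<open>N\<close>.\<close>
  let ?cl = "verma_class (1/2) 0"
  assume "evaluate x \<noteq> 0"
  obtain b where b: "fns_inner (vir.act x u) v = fns_inner u (vir.act b v)" for u v
    using vir_act_adjoint by blast
  obtain e k where k: "verma_eq (1/2) 0 (weight_filter 0 e * (b * x)) (scalar k)"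
    using weight_filter_scalar by blast
  have "fns_inner fns_vacuum (evaluate (b * x)) \<noteq> 0"
    using \<open>evaluate x \<noteq> 0\<close> fns_inner_self_eq_0[of "evaluate x"] b by (auto simp: vir.act_mult)
  then have "vev (evaluate (b * x)) \<noteq> 0"
    by (metis complex_cnj_zero fns_inner_cnj)
  moreover have "k = vev (evaluate (weight_filter 0 e * (b * x)))"
    by (simp only: evaluate_cong[OF k]) (simp add: fns_inner_scale_left fns_inner_vacuum)
  ultimately have "k \<noteq> 0"
    by (simp add: vir.act_mult[of "weight_filter 0 e"] vev_weight_filter del: of_nat_Suc)
  have "?cl (scalar k) = ?cl (weight_filter 0 e * (b * x))"
    using k by (simp add: verma_class_eq_iff verma_eq_sym)
  then have "?cl (scalar k) \<in> N"
    using verma_submodule_mult[OF N x, of "weight_filter 0 e * b"] by (simp add: mult.assoc)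
  then have "?cl (a * scalar (1 / k) * scalar k) \<in> N" for a
    by (rule verma_submodule_mult[OF N])
  then have "?cl a \<in> N" for a
    using \<open>k \<noteq> 0\<close> by (simp add: mult.assoc scalar_1 flip: scalar_mult)
  then have "N = vm_carrier verma_half"
    using N by (auto simp: vir_submodule_def verma_module_simps)
  with proper show False ..
qed

text \<open>An element of the quotient of the Verma module by the kernel of the evaluation at the vacuum is
  a fibre of that evaluation; \<open>fibre 0\<close> is the kernel itself.\<close>

definition fibre :: "fns \<Rightarrow> vir_basis free_algebra set set" where
  "fibre u = {verma_class (1/2) 0 a |a. evaluate a = u}"

lemma verma_class_in_fibre: "verma_class (1/2) 0 a \<in> fibre u \<longleftrightarrow> evaluate a = u"
  unfolding fibre_def using evaluate_cong[of a]
  by (auto simp: verma_class_eq_iff intro!: exI[of _ a])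

lemma evaluate_embed: "evaluate (vir_embed g * a) = fns_rep g (evaluate a)"
  by (simp add: fns_rep_def vir.act_mult)

lemma fns_rep_zero: "fns_rep g 0 = 0"
  using vir.act_scale_right[of "vir_embed g" 0 0] by (simp add: fns_rep_def)

lemma submodule_fibre_zero: "vir_submodule verma_half (fibre 0)"
  unfolding vir_submodule_def
proof (intro conjI ballI allI)
  show "fibre 0 \<subseteq> vm_carrier verma_half" by (auto simp: fibre_def verma_module_simps)
  show "fibre 0 \<noteq> {}" using verma_class_in_fibre[of 0 0] by auto
  fix X assume "X \<in> fibre 0"
  then obtain a where a: "X = verma_class (1/2) 0 a" "evaluate a = 0" by (auto simp: fibre_def)
  show "vm_scale verma_half k X \<in> fibre 0" for k
    by (simp add: a verma_module_simps verma_class_in_fibre vir.act_mult)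
  show "vm_act verma_half g X \<in> fibre 0" for g
    by (simp add: a verma_module_simps verma_class_in_fibre evaluate_embed fns_rep_zero)
  show "vm_add verma_half X Y \<in> fibre 0" if Y: "Y \<in> fibre 0" for Y
  proof -
    obtain b where "Y = verma_class (1/2) 0 b" "evaluate b = 0" using Y by (auto simp: fibre_def)
    with a show ?thesis
      by (simp add: verma_module_simps verma_class_in_fibre vir.act_add_left)
  qed
qed

text \<open>Every proper submodule lies in the kernel, and the kernel is proper because Omega is
  non-zero. The uniqueness resolves the \<open>THE\<close> in
  \<open>irreducible_module\<close>.\<close>

lemma maximal_submodule_verma: "maximal_proper_submodule verma_half N \<longleftrightarrow> N = fibre 0"
proof -
  have sub: "N \<subseteq> fibre 0" if "vir_submodule verma_half N" "N \<noteq> vm_carrier verma_half" for N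
  proof
    fix X assume "X \<in> N"
    moreover from this that obtain a where "X = verma_class (1/2) 0 a"
      by (auto simp: vir_submodule_def verma_module_simps)
    ultimately show "X \<in> fibre 0"
      using that by (simp add: verma_class_in_fibre proper_submodule_evaluate)
  qed
  have "verma_class (1/2) 0 1 \<notin> fibre 0"
    by (simp add: verma_class_in_fibre fns_vacuum_nonzero)
  then have "fibre 0 \<noteq> vm_carrier verma_half" by (auto simp: verma_module_simps)
  with sub submodule_fibre_zero show ?thesis
    unfolding maximal_proper_submodule_def by blast
qed

lemma irreducible_module_half:
  "irreducible_module (1/2) 0 = quotient_module verma_half (fibre 0)"
  by (simp add: irreducible_module_def maximal_submodule_verma)

lemma coset_fibre:
  "coset verma_half (fibre 0) (verma_class (1/2) 0 a) = fibre (evaluate a)"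
proof -
  have "verma_class (1/2) 0 b \<in> coset verma_half (fibre 0) (verma_class (1/2) 0 a)"
    if "evaluate b = evaluate a" for b
    unfolding coset_def
  proof (rule image_eqI)
    show "verma_class (1/2) 0 b = vm_add verma_half (verma_class (1/2) 0 a) (verma_class (1/2) 0 (b - a))"
      by (simp add: verma_module_simps)
    show "verma_class (1/2) 0 (b - a) \<in> fibre 0"
      using that by (simp add: verma_class_in_fibre vir.act_diff_left)
  qed
  then have "fibre (evaluate a) \<subseteq> coset verma_half (fibre 0) (verma_class (1/2) 0 a)"
    by (auto simp: fibre_def)
  moreover have "coset verma_half (fibre 0) (verma_class (1/2) 0 a) \<subseteq> fibre (evaluate a)"
    unfolding coset_def by (auto simp: fibre_def[of 0] verma_module_simps verma_class_in_fibre vir.act_add_left)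
  ultimately show ?thesis by blast
qed

lemma UN_fibre:
  assumes "\<And>b. evaluate b = evaluate a \<Longrightarrow> F (verma_class (1/2) 0 b) = Y"
  shows "(\<Union>X\<in>fibre (evaluate a). F X) = Y"
proof -
  have "verma_class (1/2) 0 a \<in> fibre (evaluate a)" by (simp add: verma_class_in_fibre)
  moreover have "F X = Y" if "X \<in> fibre (evaluate a)" for X
    using that assms by (auto simp: fibre_def)
  ultimately show ?thesis by blast
qed

lemma quotient_fibre_simps:
  "vm_carrier (quotient_module verma_half (fibre 0)) = fibre ` range evaluate"
  "vm_add (quotient_module verma_half (fibre 0)) (fibre (evaluate a)) (fibre (evaluate b))
    = fibre (evaluate a + evaluate b)"
  "vm_scale (quotient_module verma_half (fibre 0)) k (fibre (evaluate a)) = fibre (fns_scale k (evaluate a))"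
  "vm_act (quotient_module verma_half (fibre 0)) g (fibre (evaluate a)) = fibre (fns_rep g (evaluate a))"
  by (auto simp: quotient_module_def verma_module_simps coset_fibre image_image vir.act_add_left
      vir.act_mult evaluate_embed[unfolded vir.act_mult] intro!: UN_fibre)

lemma submodule_range_evaluate: "vir_submodule (fns_vir_module fns_rep) (range evaluate)"
  unfolding vir_submodule_def fns_vir_module_def
  by (auto simp flip: vir.act_add_left evaluate_embed)
    (metis rangeI vir.act_mult vir.act_scalar)

lemma generated_submodule_vacuum:
  "vm_carrier (generated_submodule (fns_vir_module fns_rep) fns_vacuum) = range evaluate"
proof -
  let ?M = "fns_vir_module fns_rep"
  have "evaluate a \<in> N" if N: "vir_submodule ?M N" "fns_vacuum \<in> N" for a N
  proof (induction a rule: free_algebra_induct)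
    case (gen g a)
    have "fns_rep (Poly_Mapping.single g 1) (evaluate a) \<in> N"
      using gen N by (simp add: vir_submodule_def fns_vir_module_def)
    then show ?case by (simp add: fns_rep_def vir_embed_single vir.act_mult scalar_1)
  qed (use N in \<open>simp_all add: vir_submodule_def fns_vir_module_def vir.act_add_left vir.act_mult\<close>)
  then have "range evaluate \<subseteq> vir_submodule ?M hull {fns_vacuum}"
    by (auto simp: hull_def)
  moreover have "vir_submodule ?M hull {fns_vacuum} \<subseteq> range evaluate"
  proof (rule hull_minimal)
    have "evaluate 1 = fns_vacuum" by simp
    then show "{fns_vacuum} \<subseteq> range evaluate" by (metis empty_subsetI insert_subset rangeI)
  qed (rule submodule_range_evaluate)
  ultimately show ?thesis by (auto simp: generated_submodule_def)
qed

theorem corollary3p80: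
  shows "\<exists>\<rho> :: vir \<Rightarrow> fns \<Rightarrow> fns.
    vir_representation fns_scale \<rho> \<and>
    (\<forall>n. \<rho> (Poly_Mapping.single (VL n) 1) = fns_L n) \<and>
    vir_isomorphic (generated_submodule (fns_vir_module \<rho>) fns_vacuum) (irreducible_module (1/2) 0)"
proof (intro exI[of _ fns_rep] conjI allI vir_representation_fns fns_rep_single)
  let ?V = "generated_submodule (fns_vir_module fns_rep) fns_vacuum"
  have ops: "vm_add ?V = (+)" "vm_scale ?V = fns_scale" "vm_act ?V = fns_rep"
    by (simp_all add: generated_submodule_def fns_vir_module_def)
  have "inj_on fibre (range evaluate)"
  proof (rule inj_onI)
    fix u v assume "u \<in> range evaluate" and eq: "fibre u = fibre v"
    then obtain a where "u = evaluate a" by blast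
    with eq show "u = v" by (metis verma_class_in_fibre)
  qed
  then show "vir_isomorphic ?V (irreducible_module (1/2) 0)"
    unfolding vir_isomorphic_def irreducible_module_half generated_submodule_vacuum ops
    \<comment> \<open>The witness is the inverse of the map induced by evaluation; in this direction
      no representative has to be chosen.\<close>
    by (intro exI[of _ fibre])
      (auto simp: bij_betw_def quotient_fibre_simps)
qed

end
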